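(* Let $(p_k)_{k\ge 0}$ be real numbers with $p_k\ge 0$ and $\sum_{k=0}^\infty p_k=1$, and let $(X_n)_{n\ge 0}$ be the random walk on $\{0,1,2,\dots\}$ with jump distribution $(p_k)$ at the origin. Assume: (A2$^c$) $p_k=0$ for all even $k\ge 0$; (A3) there exists $N>0$ such that $p_k=0$ for all $k>N$; (A4) the polynomial $\phi(x)=x^2+1-2x\sum_{k\ge 0}p_kx^k$ has no repeated roots (in $\mathbb{C}$). Then for every fixed integer $j\ge 0$, as $n\to\infty$, $$E(X_n\mid X_0=j)=\frac{2}{\sqrt{2\pi}}\sqrt{n}+\frac{E(Y^2)-1}{2E(Y)}+\frac{1}{\sqrt{2\pi}}\left[\frac13-\frac{E(Y^3)}{3E(Y)}+\frac{(E(Y^2)-1)^2}{2(E(Y))^2}-j\,\frac{E(Y^2)-1}{E(Y)}+j^2+\frac12(-1)^{n+j+1}\right]\frac{1}{\sqrt n}+O\left(\frac{1}{n^{3/2}}\right).$$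
   Context: The random walk $(X_n)_{n\ge0}$ is the discrete-time, time-homogeneous Markov chain on $\{0,1,2,\dots\}$ with transition probabilities $P(X_{n+1}=j-1\mid X_n=j)=P(X_{n+1}=j+1\mid X_n=j)=\frac12$ for $j\ge 1$, and $P(X_{n+1}=k\mid X_n=0)=p_k$ for $k\ge 0$. The expected position is $E(X_n\mid X_0=j)=\sum_{k=0}^\infty k\,P(X_n=k\mid X_0=j)$. $Y$ denotes a random variable with $P(Y=k)=p_k$ for $k=0,1,2,\dots$, so $E(Y^m)=\sum_{k=0}^\infty p_kk^m$. *)

theory Defs
  imports "HOL-Probability.Probability" "HOL-Library.Landau_Symbols"
    "HOL-Computational_Algebra.Polynomial"
begin

text \<open>
  A time-homogeneous Markov chain with state space \<open>nat\<close> and transition matrix \<open>Q\<close>, with no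
  restriction on the law of \<open>X 0\<close>. Conditioning is on the whole past; histories of probability
  zero are excluded, since \<^const>\<open>cond_prob\<close> is \<open>0\<close> there by division by zero.
\<close>

definition markov_chain ::
    "'a measure \<Rightarrow> (nat \<Rightarrow> nat \<Rightarrow> real) \<Rightarrow> (nat \<Rightarrow> 'a \<Rightarrow> nat) \<Rightarrow> bool" where
  "markov_chain M Q X \<longleftrightarrow>
     prob_space M \<and>
     (\<forall>n. X n \<in> measurable M (count_space UNIV)) \<and>
     (\<forall>n s k. \<P>(\<omega> in M. \<forall>i\<le>n. X i \<omega> = s i) > 0 \<longrightarrow>
        \<P>(\<omega> in M. X (Suc n) \<omega> = k \<bar> \<forall>i\<le>n. X i \<omega> = s i) = Q (s n) k)"

definition walk_trans :: "(nat \<Rightarrow> real) \<Rightarrow> nat \<Rightarrow> nat \<Rightarrow> real" where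
  "walk_trans p j k =
     (if j = 0 then p k else if k = j - 1 \<or> k = j + 1 then 1/2 else 0)"

definition cond_expected_position ::
    "'a measure \<Rightarrow> (nat \<Rightarrow> 'a \<Rightarrow> nat) \<Rightarrow> nat \<Rightarrow> nat \<Rightarrow> real" where
  "cond_expected_position M X n j =
     (\<Sum>k. real k * \<P>(\<omega> in M. X n \<omega> = k \<bar> X 0 \<omega> = j))"

definition jump_moment :: "(nat \<Rightarrow> real) \<Rightarrow> nat \<Rightarrow> real" where
  "jump_moment p m = (\<Sum>k. p k * real k ^ m)"

text \<open>
  The polynomial \<open>x\<^sup>2 + 1 - 2 x (\<Sum>k. p k * x ^ k)\<close>. The sum ranges over the support of \<open>p\<close>, so
  this is meaningful only when \<open>p\<close> has finite support.
\<close>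

definition walk_phi :: "(nat \<Rightarrow> real) \<Rightarrow> complex poly" where
  "walk_phi p =
     monom 1 2 + 1 - monom 2 1 * (\<Sum>k | p k \<noteq> 0. monom (complex_of_real (p k)) k)"

end

theory Submission
  imports Defs "HOL-Complex_Analysis.Complex_Analysis" "HOL-Real_Asymp.Real_Asymp"
begin

text \<open>
  Away from the origin the walk is a martingale, and each visit to the origin adds \<open>E(Y)\<close> to the
  expected position. Hence \<open>E(X\<^sub>n) = j + E(Y) * (\<Sum>i<n. P(X\<^sub>i = 0))\<close>, and the theorem is a statement
  about the partial sums of the return probabilities.

  Their generating function is explicit (the kernel method, \<open>kernel_equation\<close>): testing the forward
  equation against \<open>k \<mapsto> h ^ k\<close>, where \<open>z * (1 + h\<^sup>2) = 2 * h\<close>, cancels the contribution of every state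
  except the origin and leaves
  \<open>(\<Sum>n. P(X\<^sub>n = 0) * z ^ n) * (1 - z * (\<Sum>k. p k * h ^ k)) = h ^ j\<close>. As all jumps from the origin
  are odd, visits happen only at the times \<open>j + 2 * l\<close>. With \<open>y = z\<^sup>2\<close> and \<open>s = sqrt (1 - y)\<close> everything
  becomes rational in \<open>s\<close>: \<open>h = z / (1 + s)\<close>, and
  \<open>(\<Sum>l. P(X\<^bsub>j + 2 l\<^esub> = 0) * y ^ l) = 1 / ((1 + s) ^ j * D(s))\<close>, where
  \<open>D(s) = E(Y) s - (E(Y\<^sup>2) - 1) / 2 s\<^sup>2 + (E(Y\<^sup>3) - E(Y)) / 6 s\<^sup>3 + \<dots>\<close> has no zero other than
  \<open>s = 0\<close> for \<open>y\<close> in the closed unit disc (\<open>char_fun_nonzero\<close>).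

  So the partial sums have the generating function \<open>B(s) / s ^ 3\<close> with \<open>B\<close> holomorphic near the
  compact set of all these \<open>s\<close>. Expand \<open>B\<close> at \<open>0\<close>. The terms \<open>s ^ (-3)\<close>, \<open>s ^ (-2)\<close> and \<open>s ^ (-1)\<close>
  have known coefficients, which give the three displayed orders after inserting the expansion of
  \<open>(2 l choose l) / 4 ^ l\<close> obtained from Wallis' product. The terms \<open>1, s, s\<^sup>2, s\<^sup>3\<close> have coefficients of
  order \<open>l powr (-3/2)\<close> at most. The remainder \<open>s ^ 4 * g(s)\<close> has a bounded second derivative with
  respect to \<open>y\<close>, so its coefficients are of order \<open>l ^ (-2)\<close> by Cauchy's inequality
  (\<open>coeff_expansion_of_sqrt_singularity\<close>). The alternating term in the theorem comes from rounding:
  the number of summands is half of \<open>n - j - 1\<close>, rounded down, plus one.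
\<close>

section \<open>Wallis coefficients\<close>

text \<open>
  This is \<open>(2 l choose l) / 4 ^ l\<close>, the coefficient of \<open>y ^ l\<close> in \<open>1 / sqrt (1 - y)\<close>. The product form
  makes its recursion and its relation to Wallis' product immediate.
\<close>
definition half_coeff :: "nat \<Rightarrow> real" where
  "half_coeff l = (\<Prod>k<l. (2 * real k + 1) / (2 * real k + 2))"

lemma half_coeff_0 [simp]: "half_coeff 0 = 1"
  by (simp add: half_coeff_def)

lemma half_coeff_Suc: "half_coeff (Suc l) = half_coeff l * ((2 * real l + 1) / (2 * real l + 2))"
  by (simp add: half_coeff_def)

lemma half_coeff_pos: "half_coeff l > 0"
  unfolding half_coeff_def by (rule prod_pos) auto

lemma prod_wallis_eq_half_coeff:
  "(\<Prod>k=1..n. (4*real k^2) / (4*real k^2 - 1)) = 1 / (half_coeff n ^ 2 * (2 * real n + 1))"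
proof (induction n)
  case (Suc n)
  have *: "(4*real (Suc n)^2) - 1 = (2 * real n + 1) * (2 * real n + 3)"
    by (simp add: power2_eq_square algebra_simps)
  have "(\<Prod>k=1..Suc n. (4*real k^2) / (4*real k^2 - 1)) =
      1 / (half_coeff n ^ 2 * (2 * real n + 1)) * ((4*real (Suc n)^2) / ((2 * real n + 1) * (2 * real n + 3)))"
    using Suc * by (simp add: mult.commute)
  also have "\<dots> = 1 / (half_coeff (Suc n) ^ 2 * (2 * real (Suc n) + 1))"
    using half_coeff_pos[of n] by (simp add: half_coeff_Suc field_simps power2_eq_square)
  finally show ?case .
qed auto

lemma half_coeff_tendsto: "(\<lambda>n. half_coeff n ^ 2 * (2 * real n + 1)) \<longlonglongrightarrow> 2 / pi"
  using tendsto_inverse[OF wallis] unfolding prod_wallis_eq_half_coeff by simp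

lemma half_coeff_square_tendsto:
  assumes "(\<lambda>n. c n / (2 * real n + 1)) \<longlonglongrightarrow> 1 / 2"
  shows "(\<lambda>n. half_coeff n ^ 2 * c n) \<longlonglongrightarrow> 1 / pi"
proof -
  have "(\<lambda>n. half_coeff n ^ 2 * (2 * real n + 1) * (c n / (2 * real n + 1))) \<longlonglongrightarrow> 2 / pi * (1 / 2)"
    by (intro tendsto_mult half_coeff_tendsto assms)
  moreover have "half_coeff n ^ 2 * (2 * real n + 1) * (c n / (2 * real n + 1)) = half_coeff n ^ 2 * c n" for n
    by (simp add: field_simps add_pos_nonneg)
  ultimately show ?thesis by simp
qed

text \<open>
  Wallis' product only gives the leading term of \<open>half_coeff\<close>. The next one follows by
  monotonicity: the left-hand side increases to its limit \<open>1 / pi\<close>, while the slightly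
  larger quantity of the next lemma decreases to the same limit.
\<close>
lemma half_coeff_square_upper: "half_coeff l ^ 2 * (real l + 1/4) \<le> 1 / pi"
proof -
  have "incseq (\<lambda>l. half_coeff l ^ 2 * (real l + 1/4))"
  proof (rule incseq_SucI)
    fix l
    have "(real l + 1/4) \<le> ((2 * real l + 1) / (2 * real l + 2)) ^ 2 * (real (Suc l) + 1/4)"
      by (simp add: divide_simps power2_eq_square) (simp add: algebra_simps)
    from mult_left_mono[OF this, of "half_coeff l ^ 2"]
    show "half_coeff l ^ 2 * (real l + 1/4) \<le> half_coeff (Suc l) ^ 2 * (real (Suc l) + 1/4)"
      unfolding half_coeff_Suc power_mult_distrib mult.assoc by simp
  qed
  moreover have "(\<lambda>l. half_coeff l ^ 2 * (real l + 1/4)) \<longlonglongrightarrow> 1 / pi"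
    by (rule half_coeff_square_tendsto) real_asymp
  ultimately show ?thesis by (rule incseq_le)
qed

lemma half_coeff_square_lower:
  assumes "l \<ge> 1" shows "half_coeff l ^ 2 * (real l + 1/4 + 1 / (4 * real l)) \<ge> 1 / pi"
proof -
  \<comment> \<open>The sequence starts at \<open>l = 1\<close>, where \<open>1 / (4 * l)\<close> makes sense.\<close>
  define V where "V = (\<lambda>l. half_coeff (Suc l) ^ 2 * (real (Suc l) + 1/4 + 1 / (4 * real (Suc l))))"
  have "decseq V"
  proof (rule decseq_SucI)
    fix k define x where "x = real (Suc k)"
    have x: "x \<ge> 1" by (simp add: x_def)
    have "((2 * x + 1) / (2 * x + 2)) ^ 2 * (x + 1 + 1/4 + 1 / (4 * (x + 1))) \<le> x + 1/4 + 1 / (4 * x)"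
    proof -
      have "(2 * x + 1)^2 / (x + 1) = 4 * x + 1 / (x + 1)"
        using x by (simp add: field_simps power2_eq_square)
      moreover have "1 / (x + 1) \<le> 1" using x by simp
      moreover have "(2 * x + 2)^2 / x = 4 * x + 8 + 4 / x"
        using x by (simp add: field_simps power2_eq_square)
      moreover have "4 / x > 0" using x by simp
      moreover have "(2 * x + 1)^2 * (4 * x + 5) + 1 = (2 * x + 2)^2 * (4 * x + 1) + 2"
        by (simp add: power2_eq_square algebra_simps)
      moreover have scaled: "p * (x + 1 + 1/4 + 1 / (4 * (x + 1))) \<le> q * (x + 1/4 + 1 / (4 * x))"
        if "p * (4 * x + 5) + p / (x + 1) \<le> q * (4 * x + 1) + q / x" for p q
      proof -
        have "p * (x + 1 + 1/4 + 1 / (4 * (x + 1))) = (p * (4 * x + 5) + p / (x + 1)) / 4"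
          "q * (x + 1/4 + 1 / (4 * x)) = (q * (4 * x + 1) + q / x) / 4"
          using x by (simp_all add: field_simps)
        with that show ?thesis by (simp only:) (rule divide_right_mono; simp)
      qed
      ultimately have "(2 * x + 1)^2 * (4 * x + 5) + (2 * x + 1)^2 / (x + 1)
          \<le> (2 * x + 2)^2 * (4 * x + 1) + (2 * x + 2)^2 / x"
        by linarith
      then have "(2 * x + 1)^2 * (x + 1 + 1/4 + 1 / (4 * (x + 1)))
          \<le> (2 * x + 2)^2 * (x + 1/4 + 1 / (4 * x))"
        by (rule scaled)
      then show ?thesis using x
        by (simp add: power_divide pos_divide_le_eq mult.commute)
    qed
    from mult_left_mono[OF this, of "half_coeff (Suc k) ^ 2"]
    show "V (Suc k) \<le> V k"
      unfolding V_def half_coeff_Suc[of "Suc k"] power_mult_distrib mult.assoc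
      by (simp add: x_def power_divide add_ac)
  qed
  moreover have "V \<longlonglongrightarrow> 1 / pi"
    unfolding V_def
    by (rule LIMSEQ_Suc[OF half_coeff_square_tendsto]) real_asymp
  ultimately have "V (l - 1) \<ge> 1 / pi" by (rule decseq_ge)
  then show ?thesis using assms by (simp add: V_def add_ac)
qed

text \<open>
  The two shift estimates transport an expansion in powers of \<open>sqrt (2 * l + 1/2)\<close>, the natural
  variable for \<open>half_coeff\<close>, to one in powers of \<open>sqrt n\<close>, where \<open>n - 2 * l\<close> is bounded.
\<close>
lemma inverse_sqrt_shift:
  fixes x b :: real
  assumes "x > 0" "b \<ge> 0"
  shows "\<bar>1 / sqrt (x + b) - 1 / sqrt x\<bar> \<le> b / (x * sqrt x)"
proof -
  define u v where "u = sqrt x" and "v = sqrt (x + b)"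
  have uv: "0 < u" "u \<le> v" "u * u = x" "b = v * v - u * u"
    using assms by (auto simp: u_def v_def)
  have "1 / u - 1 / v = (v - u) / (u * v)" using uv by (simp add: field_simps)
  also have "\<dots> \<le> (v - u) / (u * u)" using uv by (intro divide_left_mono mult_left_mono) auto
  also have "\<dots> = (v - u) * u / (u * u * u)" using uv by simp
  also have "\<dots> \<le> (v - u) * (v + u) / (u * u * u)"
    using uv by (intro divide_right_mono mult_left_mono) auto
  also have "\<dots> = b / (u * u * u)" using uv by (simp add: algebra_simps)
  finally have "1 / u - 1 / v \<le> b / (x * u)" using uv by simp
  moreover have "1 / v \<le> 1 / u" using uv by (intro divide_left_mono) auto
  ultimately show ?thesis by (simp add: u_def v_def abs_if)
qed

lemma sqrt_shift:
  fixes x b :: real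
  assumes "x > 0" "b \<ge> 0"
  shows "\<bar>sqrt (x + b) - sqrt x - b / (2 * sqrt x)\<bar> \<le> b^2 / (x * sqrt x)"
proof -
  define u v where "u = sqrt x" and "v = sqrt (x + b)"
  have uv: "0 < u" "u \<le> v" "u * u = x" "b = v * v - u * u"
    using assms by (auto simp: u_def v_def)
  have "v - u - b / (2 * u) = - ((v - u)^2 / (2 * u))"
    using uv(1) unfolding uv(4) by (simp add: field_simps power2_eq_square)
  moreover have "(v - u)^2 / (2 * u) \<le> b^2 / (u * u * u)"
  proof -
    have "(v - u)^2 / (2 * u) = (v - u)^2 * u ^ 2 / (2 * (u * u * u))"
      using uv(1) by (simp add: field_simps power2_eq_square)
    also have "\<dots> \<le> (v - u)^2 * (v + u) ^ 2 / (2 * (u * u * u))"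
      using uv by (intro divide_right_mono mult_left_mono power_mono) auto
    also have "\<dots> = b^2 / (2 * (u * u * u))"
      unfolding power_mult_distrib[symmetric] uv(4) by (simp add: algebra_simps)
    also have "\<dots> \<le> b^2 / (u * u * u)" using uv(1) by (intro divide_left_mono) auto
    finally show ?thesis .
  qed
  moreover have "(v - u)^2 / (2 * u) \<ge> 0" using uv(1) by simp
  ultimately have "\<bar>v - u - b / (2 * u)\<bar> \<le> b^2 / (u * u * u)" by linarith
  then show ?thesis unfolding uv(3) by (simp only: u_def v_def)
qed

lemma powr_three_halves: "x > 0 \<Longrightarrow> x powr (3/2) = x * sqrt (x::real)"
  using powr_add[of x 1 "1/2"] by (simp add: powr_half_sqrt)

lemma half_coeff_upper: "half_coeff l \<le> 1 / sqrt (pi * (real l + 1/4))"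
proof -
  have "half_coeff l ^ 2 \<le> 1 / (pi * (real l + 1/4))"
    using half_coeff_square_upper[of l] by (simp add: field_simps add_pos_nonneg)
  from real_sqrt_le_mono[OF this] show ?thesis
    using half_coeff_pos[of l] by (simp add: real_sqrt_divide)
qed

lemma half_coeff_lower:
  assumes "l \<ge> 1" shows "half_coeff l \<ge> 1 / sqrt (pi * (real l + 1/4 + 1 / (4 * real l)))"
proof -
  have "real l + 1/4 + 1 / (4 * real l) > 0" using assms by (intro add_pos_pos) auto
  then have "half_coeff l ^ 2 \<ge> 1 / (pi * (real l + 1/4 + 1 / (4 * real l)))"
    using half_coeff_square_lower[OF assms] by (simp add: pos_divide_le_eq divide_simps mult_ac)
  from real_sqrt_le_mono[OF this] show ?thesis
    using half_coeff_pos[of l] by (simp add: real_sqrt_divide)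
qed

lemma half_coeff_approx:
  assumes "l \<ge> 1"
  shows "\<bar>half_coeff l - 2 / sqrt (2 * pi) / sqrt (2 * real l + 1/2)\<bar> \<le> 1 / (real l * real l * sqrt (real l))"
proof -
  define x where "x = real l + 1/4"
  define b where "b = 1 / (4 * real l)"
  have l: "real l \<ge> 1" using assms by simp
  have x: "x > 0" "b \<ge> 0" "real l \<le> x" using l by (auto simp: x_def b_def)
  have pi1: "sqrt pi \<ge> 1" using pi_gt3 by simp
  have up: "half_coeff l \<le> 1 / sqrt pi * (1 / sqrt x)"
    using half_coeff_upper[of l] by (simp add: x_def real_sqrt_mult)
  have lo: "half_coeff l \<ge> 1 / sqrt pi * (1 / sqrt (x + b))"
    using half_coeff_lower[OF assms] by (simp add: x_def b_def real_sqrt_mult)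
  have "sqrt (2 * real l + 1/2) = sqrt (2 * x)" by (simp add: x_def)
  then have eq: "2 / sqrt (2 * pi) / sqrt (2 * real l + 1/2) = 1 / sqrt pi * (1 / sqrt x)"
    using x by (simp add: real_sqrt_mult field_simps)
  have "\<bar>half_coeff l - 1 / sqrt pi * (1 / sqrt x)\<bar> \<le> 1 / sqrt pi * \<bar>1 / sqrt (x + b) - 1 / sqrt x\<bar>"
    using up lo by (subst abs_mult_pos') (auto simp: right_diff_distrib abs_if)
  also have "\<dots> \<le> 1 * (b / (x * sqrt x))"
    using pi1 x by (intro mult_mono inverse_sqrt_shift) auto
  also have "\<dots> \<le> b / (real l * sqrt (real l))"
    using x l by simp (intro divide_left_mono mult_mono mult_pos_pos; simp)
  also have "\<dots> \<le> 1 / (real l * real l * sqrt (real l))"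
    using l unfolding b_def by (simp add: field_simps)
  finally show ?thesis by (simp only: eq)
qed

lemma half_coeff_shift:
  fixes b :: real
  assumes "l \<ge> 1" "b \<ge> 0"
  shows "\<bar>half_coeff l - 2 / sqrt (2 * pi) / sqrt (2 * real l + 1/2 + b)\<bar>
           \<le> (1 + b) / (real l * sqrt (real l))"
proof -
  define x where "x = 2 * real l + 1/2"
  define k where "k = 2 / sqrt (2 * pi)"
  have l: "real l \<ge> 1" using assms by simp
  have x: "x > 0" "real l \<le> x" using l by (auto simp: x_def)
  have "sqrt (2 * pi) \<ge> sqrt 4" using pi_gt3 by (intro real_sqrt_le_mono) auto
  then have k: "0 \<le> k" "k \<le> 1" by (auto simp: k_def)
  have 1: "\<bar>half_coeff l - k / sqrt x\<bar> \<le> 1 / (real l * sqrt (real l))"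
  proof -
    have "1 / (real l * real l * sqrt (real l)) \<le> 1 / (real l * sqrt (real l))"
      using l by (intro divide_left_mono mult_right_mono mult_pos_pos) auto
    with half_coeff_approx[OF assms(1)] show ?thesis by (simp add: k_def x_def)
  qed
  have "\<bar>k / sqrt x - k / sqrt (x + b)\<bar> = k * \<bar>1 / sqrt (x + b) - 1 / sqrt x\<bar>"
    using k by (subst abs_mult_pos') (auto simp: right_diff_distrib abs_minus_commute)
  also have "\<dots> \<le> 1 * (b / (x * sqrt x))"
    using k x assms by (intro mult_mono inverse_sqrt_shift) auto
  also have "\<dots> \<le> b / (real l * sqrt (real l))"
    using x l assms by simp (intro divide_left_mono mult_mono mult_pos_pos; simp)
  finally show ?thesis using 1 unfolding k_def[symmetric] x_def[symmetric] by (simp add: add_divide_distrib)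
qed

text \<open>
  Here the factor \<open>2 * l + 1\<close> costs a full power of \<open>l\<close>; the error of order \<open>l powr (-5/2)\<close> in
  \<open>half_coeff_approx\<close> is what makes the result accurate to order \<open>l powr (-3/2)\<close>.
\<close>
lemma half_coeff_sum_shift:
  fixes b :: real
  assumes "l \<ge> 1" "b \<ge> 0"
  defines "n \<equiv> 2 * real l + 1/2 + b"
  shows "\<bar>(2 * real l + 1) * half_coeff l - 2 / sqrt (2 * pi) * (sqrt n + (1/2 - b/2) / sqrt n)\<bar>
           \<le> (3 + 2 * (1 + b)^2) / (real l * sqrt (real l))"
proof -
  define x where "x = 2 * real l + 1/2"
  define k where "k = 2 / sqrt (2 * pi)"
  define d where "d = real l * sqrt (real l)"
  have l: "real l \<ge> 1" using assms by simp
  then have d: "d > 0" by (simp add: d_def)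
  have x: "x > 0" "real l \<le> x" using l by (auto simp: x_def)
  have n: "n = x + b" by (simp add: n_def x_def)
  have "sqrt (2 * pi) \<ge> sqrt 4" using pi_gt3 by (intro real_sqrt_le_mono) auto
  then have k: "0 \<le> k" "k \<le> 1" by (auto simp: k_def)
  have dx: "c / (x * sqrt x) \<le> c / d" if "c \<ge> 0" for c
    using that x l unfolding d_def by (intro divide_left_mono mult_mono mult_pos_pos) auto
  have 1: "\<bar>(2 * real l + 1) * half_coeff l - k * (sqrt x + (1/2) / sqrt x)\<bar> \<le> 3 / d"
  proof -
    have "k * (sqrt x + (1/2) / sqrt x) = (2 * real l + 1) * (k / sqrt x)"
      using x by (simp add: field_simps x_def)
    then have "\<bar>(2 * real l + 1) * half_coeff l - k * (sqrt x + (1/2) / sqrt x)\<bar>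
        = (2 * real l + 1) * \<bar>half_coeff l - k / sqrt x\<bar>"
      by (subst abs_mult_pos') (auto simp: right_diff_distrib)
    also have "\<dots> \<le> (3 * real l) * (1 / (real l * real l * sqrt (real l)))"
      using half_coeff_approx[OF assms(1)] l unfolding k_def x_def by (intro mult_mono) auto
    also have "\<dots> = 3 / d" using l by (simp add: d_def field_simps)
    finally show ?thesis .
  qed
  have 2: "\<bar>sqrt (x + b) - sqrt x - b / (2 * sqrt x)\<bar> \<le> b^2 / d"
    using order.trans[OF sqrt_shift[OF x(1) assms(2)] dx[of "b^2"]] by simp
  have 3: "\<bar>(1/2 - b/2) * (1 / sqrt (x + b) - 1 / sqrt x)\<bar> \<le> (1 + b) * b / d"
  proof -
    have "\<bar>1/2 - b/2\<bar> * \<bar>1 / sqrt (x + b) - 1 / sqrt x\<bar> \<le> (1 + b) * (b / d)"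
      using order.trans[OF inverse_sqrt_shift[OF x(1) assms(2)] dx[of b]] assms(2)
      by (intro mult_mono) auto
    then show ?thesis by (simp add: abs_mult)
  qed
  define D where "D = (sqrt (x + b) + (1/2 - b/2) / sqrt (x + b)) - (sqrt x + (1/2) / sqrt x)"
  have "D = (sqrt (x + b) - sqrt x - b / (2 * sqrt x)) + (1/2 - b/2) * (1 / sqrt (x + b) - 1 / sqrt x)"
    by (simp add: D_def algebra_simps add_divide_distrib diff_divide_distrib)
  then have "\<bar>D\<bar> \<le> b^2 / d + (1 + b) * b / d" using 2 3 by linarith
  also have "\<dots> \<le> 2 * (1 + b)^2 / d"
    using d assms(2) by (simp add: power2_eq_square divide_simps) (simp add: algebra_simps)
  finally have D: "\<bar>D\<bar> \<le> 2 * (1 + b)^2 / d" .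
  have "k * \<bar>D\<bar> \<le> 1 * \<bar>D\<bar>" using k by (intro mult_right_mono) auto
  then have "\<bar>k * D\<bar> \<le> 2 * (1 + b)^2 / d" using D k by (simp add: abs_mult)
  moreover have "(2 * real l + 1) * half_coeff l - k * (sqrt n + (1/2 - b/2) / sqrt n)
      = ((2 * real l + 1) * half_coeff l - k * (sqrt x + (1/2) / sqrt x)) - k * D"
    by (simp add: D_def n right_diff_distrib)
  ultimately show ?thesis using 1 unfolding k_def[symmetric] d_def[symmetric]
    by (simp add: add_divide_distrib)
qed

section \<open>Coefficients of functions with a square-root singularity\<close>

lemma holomorphic_split_at_0:
  fixes f :: "complex \<Rightarrow> complex"
  assumes "f holomorphic_on U" "open U"
  obtains g where "g holomorphic_on U" "\<And>s. f s = f 0 + s * g s"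
proof
  show "(\<lambda>z. if z = 0 then deriv f 0 else (f z - f 0) / (z - 0)) holomorphic_on U"
    using assms by (rule pole_lemma_open)
qed auto

text \<open>
  The point of this form of Taylor's formula is that the remainder factor is holomorphic on all of
  \<open>U\<close>, also outside the disc of convergence of the Taylor series.
\<close>
lemma holomorphic_taylor_remainder:
  fixes f :: "complex \<Rightarrow> complex"
  assumes "f holomorphic_on U" "open U" "0 \<in> U" "f has_fps_expansion F"
  shows "\<exists>g. g holomorphic_on U \<and> (\<forall>s. f s = (\<Sum>k<n. fps_nth F k * s ^ k) + s ^ n * g s)"
proof (induction n)
  case 0
  show ?case using assms by auto
next
  case (Suc n)
  then obtain g where g: "g holomorphic_on U" "\<And>s. f s = (\<Sum>k<n. fps_nth F k * s ^ k) + s ^ n * g s"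
    by blast
  obtain h where h: "h holomorphic_on U" "\<And>s. g s = g 0 + s * h s"
    using holomorphic_split_at_0[OF g(1) assms(2)] by blast
  have "g has_fps_expansion fps_expansion g 0"
    using assms g by blast
  then have "f has_fps_expansion (\<Sum>k<n. fps_const (fps_nth F k) * fps_X ^ k) + fps_X ^ n * fps_expansion g 0"
    unfolding g(2) by (intro fps_expansion_intros)
  with assms have "F = (\<Sum>k<n. fps_const (fps_nth F k) * fps_X ^ k) + fps_X ^ n * fps_expansion g 0"
    by (metis fps_expansion_unique_complex)
  then have "fps_nth F n = fps_nth ((\<Sum>k<n. fps_const (fps_nth F k) * fps_X ^ k) + fps_X ^ n * fps_expansion g 0) n"
    by simp
  also have "\<dots> = g 0"
    by (simp add: fps_sum_nth fps_X_power_mult_nth) (simp add: fps_expansion_def)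
  finally have "fps_nth F n = g 0" .
  then have "f s = (\<Sum>k<Suc n. fps_nth F k * s ^ k) + s ^ Suc n * h s" for s
    using g(2)[of s] h(2)[of s] by (simp add: algebra_simps)
  with h(1) show ?case by blast
qed

text \<open>
  Cauchy's inequality for the second derivative on circles of radius \<open>r < 1\<close>, in the limit
  \<open>r \<longrightarrow> 1\<close>.
\<close>
lemma power_series_coeff_bound:
  fixes a :: "nat \<Rightarrow> complex"
  assumes sums: "\<And>y. norm y < 1 \<Longrightarrow> (\<lambda>l. a l * y ^ l) sums f y"
    and d1: "\<And>y. norm y < 1 \<Longrightarrow> (f has_field_derivative f1 y) (at y)"
    and d2: "\<And>y. norm y < 1 \<Longrightarrow> (f1 has_field_derivative f2 y) (at y)"
    and bound: "\<And>y. norm y < 1 \<Longrightarrow> norm (f2 y) \<le> M"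
  shows "norm (a (l + 2)) * (real l + 1) * (real l + 2) \<le> M"
proof -
  have ev: "eventually (\<lambda>y::complex. y \<in> ball 0 1) (nhds 0)"
    by (intro eventually_nhds_in_open) auto
  have exp: "f has_fps_expansion Abs_fps a"
    by (rule has_fps_expansionI, rule eventually_mono[OF ev]) (use sums in auto)
  have der: "deriv f y = f1 y" "deriv f1 y = f2 y" if "norm y < 1" for y
    using d1[OF that] d2[OF that] by (auto intro: DERIV_imp_deriv)
  have "f1 has_fps_expansion fps_deriv (Abs_fps a)"
    using has_fps_expansion_deriv[OF exp]
    by (rule has_fps_expansion_cong[THEN iffD1, rotated -1])
       (auto intro!: eventually_mono[OF ev] simp: der)
  from has_fps_expansion_deriv[OF this]
  have exp2: "f2 has_fps_expansion fps_deriv (fps_deriv (Abs_fps a))"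
    by (rule has_fps_expansion_cong[THEN iffD1, rotated -1])
       (auto intro!: eventually_mono[OF ev] simp: der)
  have "f1 holomorphic_on ball 0 1"
    using d2 by (intro holomorphic_onI) (auto simp: field_differentiable_def intro: has_field_derivative_at_within)
  then have "deriv f1 holomorphic_on ball 0 1"
    by (rule holomorphic_deriv) auto
  then have hol: "f2 holomorphic_on ball 0 1"
    by (rule holomorphic_transform) (auto simp: der)
  define c where "c = fps_nth (fps_deriv (fps_deriv (Abs_fps a))) l"
  have le: "norm c * r ^ l \<le> M" if r: "0 < r" "r < 1" for r
  proof -
    have cauchy: "norm ((deriv ^^ l) f2 0) \<le> fact l * M / r ^ l"
    proof (rule Cauchy_inequality)
      show "f2 holomorphic_on ball 0 r"
        using r by (intro holomorphic_on_subset[OF hol]) auto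
      show "continuous_on (cball 0 r) f2"
        using r by (intro continuous_on_subset[OF holomorphic_on_imp_continuous_on[OF hol]]) auto
    qed (use r bound in auto)
    have c: "c = (deriv ^^ l) f2 0 / fact l"
      unfolding c_def by (rule fps_nth_fps_expansion[OF exp2])
    have "norm ((deriv ^^ l) f2 0) = fact l * norm c"
      unfolding c by (simp add: norm_divide)
    with cauchy have "fact l * norm c \<le> fact l * M / r ^ l" by simp
    then have "fact l * (norm c * r ^ l) \<le> fact l * M"
      using r by (simp add: pos_le_divide_eq mult.assoc)
    then show ?thesis by simp
  qed
  have "((\<lambda>r. norm c * r ^ l) \<longlongrightarrow> norm c * 1 ^ l) (at_left (1::real))"
    by (intro tendsto_intros)
  then have "norm c * 1 ^ l \<le> M"
  proof (rule tendsto_upperbound)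
    show "\<forall>\<^sub>F r in at_left 1. norm c * r ^ l \<le> M"
      using eventually_at_left_real[of 0 1] by (rule eventually_mono) (auto intro: le)
  qed auto
  moreover have "norm c = norm (a (l + 2)) * (real l + 1) * (real l + 2)"
  proof -
    have "c = of_real ((real l + 1) * (real l + 2)) * a (l + 2)"
      by (simp add: c_def algebra_simps)
    then show ?thesis by (simp only: norm_mult norm_of_real) (simp add: mult_ac)
  qed
  ultimately show ?thesis by simp
qed

text \<open>The image of the closed unit disc under \<open>y \<mapsto> csqrt (1 - y)\<close>.\<close>
definition sqrt_disc :: "complex set" where
  "sqrt_disc = {s. 0 \<le> Re s \<and> norm (1 - s\<^sup>2) \<le> 1}"

lemma compact_sqrt_disc: "compact sqrt_disc"
proof -
  have "closed sqrt_disc"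
    unfolding sqrt_disc_def
    by (intro closed_Collect_conj closed_Collect_le continuous_intros)
  moreover have "bounded sqrt_disc"
  proof (rule boundedI)
    fix s assume "s \<in> sqrt_disc"
    then have "norm (1 - s\<^sup>2) \<le> 1" by (simp add: sqrt_disc_def)
    then have "norm (s\<^sup>2) \<le> 2" using norm_triangle_ineq4[of 1 "1 - s\<^sup>2"] by simp
    then have "norm s ^ 2 \<le> 2 ^ 2" by (simp add: norm_power)
    then show "norm s \<le> 2" by (rule power2_le_imp_le) auto
  qed
  ultimately show ?thesis by (simp add: compact_eq_bounded_closed)
qed

lemma csqrt_in_sqrt_disc: "norm y \<le> 1 \<Longrightarrow> csqrt (1 - y) \<in> sqrt_disc"
  using csqrt_principal[of "1 - y"] by (auto simp: sqrt_disc_def)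

lemma zero_in_sqrt_disc: "0 \<in> sqrt_disc"
  by (simp add: sqrt_disc_def)

lemma one_minus_notin_nonpos_Reals: "norm (y::complex) < 1 \<Longrightarrow> 1 - y \<notin> \<real>\<^sub>\<le>\<^sub>0"
  using abs_Re_le_cmod[of y] by (auto simp: complex_nonpos_Reals_iff)

text \<open>
  As \<open>ds/dy = -1 / (2 * s)\<close>, differentiating with respect to \<open>y\<close> lowers the power of \<open>s\<close> by two and
  otherwise preserves the shape: a power of \<open>s\<close> times a holomorphic function of \<open>s\<close>.
\<close>
lemma has_field_derivative_csqrt_power_mult:
  assumes g: "g holomorphic_on U" "open U" "sqrt_disc \<subseteq> U" and y: "norm y < 1"
  shows "((\<lambda>y. csqrt (1 - y) ^ (m + 2) * g (csqrt (1 - y))) has_field_derivative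
            csqrt (1 - y) ^ m * (- (of_nat (m + 2) * g (csqrt (1 - y))
               + csqrt (1 - y) * deriv g (csqrt (1 - y))) / 2)) (at y)"
proof -
  define s where "s = csqrt (1 - y)"
  have s: "s \<noteq> 0" "s \<in> U"
    using y g csqrt_in_sqrt_disc[of y] unfolding s_def by auto
  have ds: "((\<lambda>y. csqrt (1 - y)) has_field_derivative (- 1 / (2 * s))) (at y)"
    unfolding s_def using one_minus_notin_nonpos_Reals[OF y]
    by (auto intro!: derivative_eq_intros)
  have dg: "(g has_field_derivative deriv g s) (at s)"
    using g s by (auto intro: holomorphic_derivI)
  have dp: "((\<lambda>s. s ^ (m + 2)) has_field_derivative of_nat (m + 2) * s ^ (m + 1)) (at s)"
    by (rule DERIV_power[OF DERIV_ident, THEN DERIV_cong]) simp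
  have "((\<lambda>s. s ^ (m + 2) * g s) has_field_derivative
      of_nat (m + 2) * s ^ (m + 1) * g s + s ^ (m + 2) * deriv g s) (at s)"
    using DERIV_mult[OF dp dg] by (simp add: algebra_simps)
  note chain = DERIV_chain2[OF this[unfolded s_def] ds[unfolded s_def]]
  have "(n * s ^ (m + 1) * G + s ^ (m + 2) * G') * (- 1 / (2 * s)) = s ^ m * (- (n * G + s * G') / 2)" for n G G'
    using s(1) by (simp add: field_simps)
  from DERIV_cong[OF chain this[unfolded s_def]] show ?thesis .
qed

text \<open>
  The order \<open>O(l powr (-3/2))\<close> with a bound valid for all \<open>l\<close>; the shift by one avoids a
  special case at \<open>l = 0\<close>.
\<close>
definition three_halves_decay :: "(nat \<Rightarrow> complex) \<Rightarrow> bool" where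
  "three_halves_decay a \<longleftrightarrow> (\<exists>C. \<forall>l. norm (a l) * (real (l + 1) * sqrt (real (l + 1))) \<le> C)"

lemma three_halves_decayI:
  "(\<And>l. norm (a l) * (real (l + 1) * sqrt (real (l + 1))) \<le> C) \<Longrightarrow> three_halves_decay a"
  unfolding three_halves_decay_def by blast

lemma three_halves_decay_add:
  assumes "three_halves_decay a" "three_halves_decay b"
  shows "three_halves_decay (\<lambda>l. a l + b l)"
proof -
  obtain A B where AB: "\<And>l. norm (a l) * (real (l + 1) * sqrt (real (l + 1))) \<le> A"
    "\<And>l. norm (b l) * (real (l + 1) * sqrt (real (l + 1))) \<le> B"
    using assms unfolding three_halves_decay_def by blast
  show ?thesis
  proof (rule three_halves_decayI)
    fix l
    have "norm (a l + b l) * (real (l + 1) * sqrt (real (l + 1)))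
        \<le> (norm (a l) + norm (b l)) * (real (l + 1) * sqrt (real (l + 1)))"
      by (intro mult_right_mono norm_triangle_ineq) auto
    also have "\<dots> \<le> A + B" unfolding distrib_right by (intro add_mono AB)
    finally show "norm (a l + b l) * (real (l + 1) * sqrt (real (l + 1))) \<le> A + B" .
  qed
qed

lemma three_halves_decay_cmult:
  assumes "three_halves_decay a"
  shows "three_halves_decay (\<lambda>l. c * a l)"
proof -
  obtain A where A: "\<And>l. norm (a l) * (real (l + 1) * sqrt (real (l + 1))) \<le> A"
    using assms unfolding three_halves_decay_def by blast
  have "norm (c * a l) * (real (l + 1) * sqrt (real (l + 1))) \<le> norm c * A" for l
    using mult_left_mono[OF A[of l], of "norm c"] by (simp only: norm_mult mult.assoc norm_ge_zero)
  then show ?thesis by (rule three_halves_decayI)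
qed

lemma three_halves_weight_Suc:
  "real (Suc k + 1) * sqrt (real (Suc k + 1)) \<le> 3 * (real (k + 1) * sqrt (real (k + 1)))"
proof -
  have "sqrt (real (Suc k + 1)) \<le> sqrt (9/4 * real (k + 1))"
    by (rule real_sqrt_le_mono) auto
  also have "\<dots> = 3/2 * sqrt (real (k + 1))"
    using real_sqrt_mult_self[of "3/2"] by (simp only: real_sqrt_mult real_sqrt_divide) simp
  finally have "real (Suc k + 1) * sqrt (real (Suc k + 1)) \<le> (2 * real (k + 1)) * (3/2 * sqrt (real (k + 1)))"
    by (intro mult_mono) auto
  then show ?thesis by (simp add: algebra_simps)
qed

text \<open>
  Two differentiations turn \<open>s ^ 4 * g s\<close> into a holomorphic function of \<open>s\<close>, which is bounded on
  the compact set \<open>sqrt_disc\<close>; this is why the remainder has to start at the fourth power. At \<open>y = 0\<close>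
  the power series identity follows by continuity.
\<close>
lemma coeff_bound_of_sqrt_power4:
  fixes a :: "nat \<Rightarrow> complex"
  assumes g: "g holomorphic_on U" "open U" "sqrt_disc \<subseteq> U"
    and sums: "\<And>y. norm y < 1 \<Longrightarrow> y \<noteq> 0 \<Longrightarrow>
                 (\<lambda>l. a l * y ^ l) sums (csqrt (1 - y) ^ 4 * g (csqrt (1 - y)))"
  shows "three_halves_decay a"
proof -
  define f where "f = (\<lambda>y. csqrt (1 - y) ^ 4 * g (csqrt (1 - y)))"
  define g1 where "g1 = (\<lambda>s. - (of_nat (2 + 2) * g s + s * deriv g s) / 2)"
  define g2 where "g2 = (\<lambda>s. - (of_nat (0 + 2) * g1 s + s * deriv g1 s) / 2)"
  have g1: "g1 holomorphic_on U" unfolding g1_def using g by (intro holomorphic_intros) auto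
  have g2: "g2 holomorphic_on U" unfolding g2_def using g1 g by (intro holomorphic_intros) auto
  have df: "(f has_field_derivative csqrt (1 - y) ^ 2 * g1 (csqrt (1 - y))) (at y)" if "norm y < 1" for y
    using has_field_derivative_csqrt_power_mult[OF g that, of 2] by (simp add: f_def g1_def)
  have df1: "((\<lambda>y. csqrt (1 - y) ^ 2 * g1 (csqrt (1 - y))) has_field_derivative g2 (csqrt (1 - y))) (at y)"
    if "norm y < 1" for y
    using has_field_derivative_csqrt_power_mult[OF g1 g(2,3) that, of 0] by (simp add: g2_def power2_eq_square)
  have "bounded (g2 ` sqrt_disc)"
    using g2 g compact_sqrt_disc
    by (intro compact_imp_bounded compact_continuous_image)
       (auto intro: holomorphic_on_imp_continuous_on holomorphic_on_subset)
  then obtain M where M: "\<And>s. s \<in> sqrt_disc \<Longrightarrow> norm (g2 s) \<le> M"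
    by (auto simp: bounded_iff)
  have sums': "(\<lambda>l. a l * y ^ l) sums f y" if y: "norm y < 1" for y
  proof (cases "y = 0")
    case True
    have "(f \<longlongrightarrow> a 0) (at 0)"
      by (rule powser_limit_0_strong[of 1]) (use sums f_def in auto)
    moreover have "isCont f 0"
      using df[of 0] by (auto intro: DERIV_isCont)
    ultimately have "f 0 = a 0"
      using LIM_unique by (auto simp: isCont_def)
    then show ?thesis using True powser_sums_zero[of a] by simp
  qed (use sums y f_def in auto)
  have le: "norm (a (l + 2)) * (real l + 1) * (real l + 2) \<le> M" for l
    by (rule power_series_coeff_bound[OF sums' df df1]) (use M csqrt_in_sqrt_disc in \<open>auto simp: less_imp_le\<close>)
  have M0: "M \<ge> 0" using M[OF zero_in_sqrt_disc] norm_ge_zero order.trans by blast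
  show ?thesis
  proof (rule three_halves_decayI)
    fix l :: nat
    define d where "d = real (l + 1) * sqrt (real (l + 1))"
    have d: "d \<ge> 0" by (simp add: d_def)
    consider "l = 0" | "l = 1" | "l \<ge> 2" by linarith
    then have "norm (a l) * d \<le> 3 * M \<or> norm (a l) * d \<le> 3 * norm (a 0) \<or> norm (a l) * d \<le> 3 * norm (a 1)"
    proof cases
      case 2
      have "sqrt 2 \<le> 3/2" by (rule real_le_lsqrt) (auto simp: power2_eq_square)
      then have "d \<le> 3" using 2 by (simp add: d_def)
      then show ?thesis using 2 mult_left_mono[of d 3 "norm (a l)"] by (simp add: mult.commute)
    next
      case 3
      then obtain k where k: "l = k + 2" by (metis add.commute le_Suc_ex)
      have "sqrt (real k + 3) \<le> real k + 2"
        by (rule real_le_lsqrt) (auto simp: power2_eq_square algebra_simps)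
      then have "d \<le> (3 * (real k + 1)) * (real k + 2)"
        unfolding d_def k by (intro mult_mono) (auto simp: add_ac)
      from mult_left_mono[OF this, of "norm (a l)"]
      have "norm (a l) * d \<le> 3 * (norm (a l) * (real k + 1) * (real k + 2))"
        by (simp only: mult_ac norm_ge_zero)
      with le[of k] show ?thesis by (simp add: k)
    qed (auto simp: d_def)
    moreover have "norm (a 0) \<ge> 0" "norm (a 1) \<ge> 0" by auto
    ultimately show "norm (a l) * d \<le> 3 * M + 3 * norm (a 0) + 3 * norm (a 1)"
      using M0 by linarith
  qed
qed

text \<open>On generating functions, \<open>bdiff\<close> is multiplication by \<open>1 - y\<close>.\<close>
definition bdiff :: "(nat \<Rightarrow> 'a::ab_group_add) \<Rightarrow> nat \<Rightarrow> 'a" where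
  "bdiff a l = a l - (if l = 0 then 0 else a (l - 1))"

lemma sums_bdiff:
  fixes a :: "nat \<Rightarrow> complex"
  assumes "(\<lambda>l. a l * y ^ l) sums A"
  shows "(\<lambda>l. bdiff a l * y ^ l) sums ((1 - y) * A)"
proof -
  define b where "b = (\<lambda>l. if l = 0 then 0 else a (l - 1) * y ^ l)"
  have "(\<lambda>l. b (Suc l)) sums (y * A)"
    using sums_mult[OF assms, of y] by (simp add: b_def mult_ac)
  then have "b sums (y * A)"
    by (simp only: sums_Suc_iff) (simp add: b_def)
  moreover have "a l * y ^ l - b l = bdiff a l * y ^ l" for l
    by (simp add: b_def bdiff_def algebra_simps)
  ultimately show ?thesis using sums_diff[OF assms, of b "y * A"] by (simp add: algebra_simps)
qed

text \<open>
  The converse of \<open>sums_bdiff\<close>. The growth bound provides convergence in the open unit disc; its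
  form is the one met by \<open>half_coeff_sum\<close> and by partial sums of probabilities.
\<close>
lemma sums_of_bdiff:
  fixes a :: "nat \<Rightarrow> complex"
  assumes "(\<lambda>l. bdiff a l * y ^ l) sums A" and y: "norm y < 1"
    and bound: "\<And>l. norm (a l) \<le> 2 * real l + 1"
  shows "(\<lambda>l. a l * y ^ l) sums (A / (1 - y))"
proof -
  have "summable (\<lambda>l. a l * y ^ l)"
  proof (rule summable_comparison_test')
    show "summable (\<lambda>l. 2 * (of_nat (Suc l) * norm y ^ l))"
      using geometric_deriv_sums[of "norm y"] y by (intro summable_mult) (auto simp: sums_iff)
    have "norm (a l) \<le> 2 * of_nat (Suc l)" for l
      using bound[of l] by simp
    then show "norm (a l * y ^ l) \<le> 2 * (of_nat (Suc l) * norm y ^ l)" for l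
      by (simp add: norm_mult norm_power mult_right_mono flip: mult.assoc del: of_nat_Suc)
  qed
  then obtain B where B: "(\<lambda>l. a l * y ^ l) sums B" by (auto simp: summable_def)
  have "A = (1 - y) * B" using sums_bdiff[OF B] assms(1) by (rule sums_unique2[rotated])
  moreover have "1 - y \<noteq> 0" using y by auto
  ultimately show ?thesis using B by simp
qed

lemma half_coeff_gbinomial: "of_real (half_coeff l) = ((-1/2 :: complex) gchoose l) * (-1) ^ l"
proof (induction l)
  case (Suc l)
  have "of_nat (Suc l) * ((-1/2 :: complex) gchoose Suc l) = (-1/2 - of_nat l) * ((-1/2) gchoose l)"
    using gbinomial_mult_1[of "-1/2 :: complex" l] by (simp add: algebra_simps)
  then have *: "((-1/2 :: complex) gchoose Suc l) = (-1/2 - of_nat l) * ((-1/2) gchoose l) / of_nat (Suc l)"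
    by (metis nonzero_mult_div_cancel_left of_nat_neq_0)
  have "(2 * real l + 1) / (2 * real l + 2) = (1/2 + real l) / real (Suc l)"
    by (simp add: field_simps)
  then have "complex_of_real (half_coeff (Suc l)) = of_real (half_coeff l) * ((1/2 + of_nat l) / of_nat (Suc l))"
    by (simp only: half_coeff_Suc of_real_mult of_real_divide of_real_add of_real_of_nat_eq of_real_1 of_real_numeral)
  moreover have "(-1/2 - of_nat l :: complex) = - (1/2 + of_nat l)" by simp
  ultimately show ?case
    unfolding Suc * by (simp only: power_Suc times_divide_eq_right times_divide_eq_left mult_minus_left
        mult_minus_right minus_minus mult_1_left mult_ac minus_divide_left[symmetric])
qed auto

lemma sums_half_coeff:
  assumes "norm y < 1"
  shows "(\<lambda>l. of_real (half_coeff l) * y ^ l) sums (1 / csqrt (1 - y))"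
proof -
  have "csqrt (1 - y) = (1 - y) powr (1/2)"
    by (intro csqrt_conv_powr)
  moreover have "(1 - y) powr (-(1/2)) = inverse ((1 - y) powr (1/2))"
    by (rule powr_minus)
  ultimately have "(1 - y) powr (-1/2) = 1 / csqrt (1 - y)"
    by (simp only: minus_divide_left inverse_eq_divide)
  moreover have "(\<lambda>n. ((-1/2) gchoose n) * (-y) ^ n) sums (1 + (-y)) powr (-1/2)"
    by (rule gen_binomial_complex) (use assms in auto)
  moreover have "((-1/2 :: complex) gchoose n) * (-y) ^ n = of_real (half_coeff n) * y ^ n" for n
    unfolding half_coeff_gbinomial by (simp add: power_minus[of y])
  ultimately show ?thesis by simp
qed

text \<open>
  The partial sum \<open>\<Sum>i\<le>l. half_coeff i\<close> in closed form, hence the coefficient of \<open>y ^ l\<close> in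
  \<open>(1 - y) powr (-3/2)\<close>.
\<close>
definition half_coeff_sum :: "nat \<Rightarrow> real" where
  "half_coeff_sum l = (2 * real l + 1) * half_coeff l"

lemma half_coeff_le_1: "half_coeff l \<le> 1"
  unfolding half_coeff_def by (intro prod_le_1) auto

lemma bdiff_half_coeff_sum: "bdiff half_coeff_sum l = half_coeff l"
  by (cases l) (auto simp: bdiff_def half_coeff_sum_def half_coeff_Suc field_simps)

lemma sums_half_coeff_sum:
  assumes "norm y < 1"
  shows "(\<lambda>l. of_real (half_coeff_sum l) * y ^ l) sums (1 / csqrt (1 - y) ^ 3)"
proof -
  have "bdiff (\<lambda>l. of_real (half_coeff_sum l)) l = complex_of_real (half_coeff l)" for l
    using bdiff_half_coeff_sum[of l] by (auto simp: bdiff_def simp flip: of_real_diff)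
  then have "(\<lambda>l. of_real (half_coeff_sum l) * y ^ l) sums (1 / csqrt (1 - y) / (1 - y))"
    using sums_half_coeff[OF assms] half_coeff_le_1 half_coeff_pos[THEN less_imp_le] assms
    by (intro sums_of_bdiff) (auto simp: half_coeff_sum_def abs_mult mult_left_le simp del: of_real_mult)
  also have "1 / csqrt (1 - y) / (1 - y) = 1 / csqrt (1 - y) ^ 3"
    using power2_csqrt[of "1 - y"] by (simp add: power3_eq_cube power2_eq_square)
  finally show ?thesis .
qed

lemma three_halves_decay_bdiff:
  assumes "three_halves_decay a"
  shows "three_halves_decay (bdiff a)"
proof -
  obtain A where A: "\<And>l. norm (a l) * (real (l + 1) * sqrt (real (l + 1))) \<le> A"
    using assms unfolding three_halves_decay_def by blast
  have "three_halves_decay (\<lambda>l. - (if l = 0 then 0 else a (l - 1)))"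
  proof (rule three_halves_decayI)
    fix l
    have "0 \<le> A" using order.trans[OF norm_ge_zero A[of 0, simplified]] .
    moreover have "norm (a k) * (real (Suc k + 1) * sqrt (real (Suc k + 1))) \<le> 3 * A" for k
      using mult_left_mono[OF three_halves_weight_Suc[of k], of "norm (a k)"] A[of k] by simp
    ultimately show "norm (- (if l = 0 then 0 else a (l - 1))) * (real (l + 1) * sqrt (real (l + 1))) \<le> 3 * A"
      by (cases l) auto
  qed
  from three_halves_decay_add[OF assms this] show ?thesis
    by (simp add: bdiff_def[abs_def])
qed

lemma half_coeff_le_inverse_sqrt: "half_coeff k \<le> 1 / sqrt (real k + 1)"
proof (cases "k = 0")
  case False
  have "3 * (real k + 1/4) \<le> pi * (real k + 1/4)"
    using pi_gt3 by (intro mult_right_mono) auto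
  then have "real k + 1 \<le> pi * (real k + 1/4)" using False by simp
  then have "1 / sqrt (pi * (real k + 1/4)) \<le> 1 / sqrt (real k + 1)"
    by (intro divide_left_mono real_sqrt_le_mono) auto
  with half_coeff_upper[of k] show ?thesis by linarith
qed auto

lemma three_halves_decay_bdiff_half_coeff:
  "three_halves_decay (bdiff (\<lambda>l. complex_of_real (half_coeff l)))"
proof (rule three_halves_decayI)
  fix l
  show "norm (bdiff (\<lambda>l. complex_of_real (half_coeff l)) l) * (real (l + 1) * sqrt (real (l + 1))) \<le> 3"
  proof (cases l)
    case (Suc k)
    have "half_coeff (Suc k) - half_coeff k = - (half_coeff k / (2 * (real k + 1)))"
      by (simp add: half_coeff_Suc field_simps)
    then have "norm (bdiff (\<lambda>l. complex_of_real (half_coeff l)) l) = half_coeff k / (2 * (real k + 1))"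
      using half_coeff_pos[of k] by (simp add: bdiff_def Suc del: of_real_divide of_real_minus flip: of_real_diff)
    also have "\<dots> \<le> 1 / sqrt (real k + 1) / (2 * (real k + 1))"
      by (intro divide_right_mono half_coeff_le_inverse_sqrt) auto
    finally have "norm (bdiff (\<lambda>l. complex_of_real (half_coeff l)) l) * (real (l + 1) * sqrt (real (l + 1)))
        \<le> 1 / sqrt (real k + 1) / (2 * (real k + 1)) * (3 * (real (k + 1) * sqrt (real (k + 1))))"
      unfolding Suc by (rule mult_mono[OF _ three_halves_weight_Suc]) auto
    also have "\<dots> \<le> 3"
    proof -
      have "1 / q / (2 * x) * (3 * (x * q)) \<le> 3" if "q > 0" "x > 0" for q x :: real
        using that by simp
      from this[of "sqrt (real k + 1)" "real k + 1"] show ?thesis by (simp add: add.commute)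
    qed
    finally show ?thesis .
  qed (auto simp: bdiff_def)
qed

text \<open>
  Expand \<open>B\<close> up to order seven. In \<open>B s / s ^ 3\<close> the terms \<open>s ^ (-3)\<close>, \<open>s ^ (-2)\<close>, \<open>s ^ (-1)\<close> carry
  the expansion; \<open>1\<close> and \<open>s\<^sup>2\<close> are polynomials in \<open>y\<close>; \<open>s\<close> and \<open>s ^ 3\<close> are \<open>1 / s\<close> multiplied by powers
  of \<open>1 - y\<close>, so their coefficients are iterated differences of \<open>half_coeff\<close>. What is left is
  \<open>s ^ 4 * g s\<close>.
\<close>
theorem coeff_expansion_of_sqrt_singularity:
  fixes a :: "nat \<Rightarrow> complex" and B :: "complex \<Rightarrow> complex"
  assumes B: "B holomorphic_on U" "open U" "sqrt_disc \<subseteq> U" "B has_fps_expansion F"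
    and sums: "\<And>y. norm y < 1 \<Longrightarrow> y \<noteq> 0 \<Longrightarrow>
                 (\<lambda>l. a l * y ^ l) sums (B (csqrt (1 - y)) / csqrt (1 - y) ^ 3)"
  shows "three_halves_decay
           (\<lambda>l. a l - (fps_nth F 0 * half_coeff_sum l + fps_nth F 1 + fps_nth F 2 * half_coeff l))"
proof -
  define b where "b = fps_nth F"
  define W where "W = (\<lambda>l. complex_of_real (half_coeff l))"
  define T where "T = (\<lambda>l. complex_of_real (half_coeff_sum l))"
  define \<delta> where "\<delta> = (\<lambda>l::nat. if l = 0 then 1 else 0 :: complex)"
  obtain g where g: "g holomorphic_on U" "\<And>s. B s = (\<Sum>k<7. b k * s ^ k) + s ^ 7 * g s"
    using holomorphic_taylor_remainder[OF B(1,2) _ B(4), of 7] B(3) zero_in_sqrt_disc unfolding b_def by blast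
  define small where "small = (\<lambda>l. b 3 * \<delta> l + b 4 * bdiff W l + b 5 * bdiff \<delta> l + b 6 * bdiff (bdiff W) l)"
  define r where "r = (\<lambda>l. a l - (b 0 * T l + b 1 * 1 + b 2 * W l) - small l)"
  have "three_halves_decay r"
  proof (rule coeff_bound_of_sqrt_power4[OF g(1) B(2,3)])
    fix y :: complex assume y: "norm y < 1" "y \<noteq> 0"
    define s where "s = csqrt (1 - y)"
    have s: "s \<noteq> 0" "1 - y = s\<^sup>2" using y by (auto simp: s_def)
    have W: "(\<lambda>l. W l * y ^ l) sums (1 / s)"
      unfolding W_def s_def by (rule sums_half_coeff[OF y(1)])
    have T: "(\<lambda>l. T l * y ^ l) sums (1 / s ^ 3)"
      unfolding T_def s_def by (rule sums_half_coeff_sum[OF y(1)])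
    have one: "(\<lambda>l. 1 * y ^ l) sums (1 / s\<^sup>2)"
      using geometric_sums[OF y(1)] by (simp add: s(2))
    have \<delta>: "(\<lambda>l. \<delta> l * y ^ l) sums 1"
      using powser_sums_zero sums_single[of 0 "\<lambda>_. 1::complex"] by (simp add: \<delta>_def if_distrib[of "\<lambda>x. x * _"] cong: if_cong)
    have "(\<lambda>l. a l * y ^ l - (b 0 * (T l * y ^ l) + b 1 * (1 * y ^ l) + b 2 * (W l * y ^ l))
        - (b 3 * (\<delta> l * y ^ l) + b 4 * (bdiff W l * y ^ l) + b 5 * (bdiff \<delta> l * y ^ l)
           + b 6 * (bdiff (bdiff W) l * y ^ l)))
      sums (B s / s ^ 3 - (b 0 * (1 / s ^ 3) + b 1 * (1 / s\<^sup>2) + b 2 * (1 / s))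
        - (b 3 * 1 + b 4 * ((1 - y) * (1 / s)) + b 5 * ((1 - y) * 1)
           + b 6 * ((1 - y) * ((1 - y) * (1 / s)))))"
      using sums[OF y] unfolding s_def[symmetric]
      by (intro sums_diff sums_add sums_mult sums_bdiff W T one \<delta>)
    also have "B s / s ^ 3 - (b 0 * (1 / s ^ 3) + b 1 * (1 / s\<^sup>2) + b 2 * (1 / s))
        - (b 3 * 1 + b 4 * ((1 - y) * (1 / s)) + b 5 * ((1 - y) * 1)
           + b 6 * ((1 - y) * ((1 - y) * (1 / s)))) = s ^ 4 * g s"
    proof -
      define q where "q = b 3 + b 4 * s + b 5 * s\<^sup>2 + b 6 * s ^ 3 + s ^ 4 * g s"
      have "B s = b 0 + b 1 * s + b 2 * s\<^sup>2 + s ^ 3 * q"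
        unfolding g(2) q_def by (simp add: eval_nat_numeral algebra_simps)
      then have "B s / s ^ 3 = b 0 * (1 / s ^ 3) + b 1 * (1 / s\<^sup>2) + b 2 * (1 / s) + q"
        using s(1) by (simp add: add_divide_distrib power2_eq_square power3_eq_cube)
      then show ?thesis
        using s(1) unfolding s(2) q_def by (simp add: power2_eq_square power3_eq_cube)
    qed
    finally show "(\<lambda>l. r l * y ^ l) sums (csqrt (1 - y) ^ 4 * g (csqrt (1 - y)))"
      unfolding s_def[symmetric] r_def small_def by (simp add: algebra_simps)
  qed
  moreover have "three_halves_decay small"
  proof -
    have "three_halves_decay \<delta>"
      by (rule three_halves_decayI[where C = 1]) (auto simp: \<delta>_def)
    then show ?thesis
      unfolding small_def W_def
      by (intro three_halves_decay_add three_halves_decay_cmult three_halves_decay_bdiff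
            three_halves_decay_bdiff_half_coeff)
  qed
  ultimately have "three_halves_decay (\<lambda>l. r l + small l)"
    by (rule three_halves_decay_add)
  then show ?thesis by (simp add: r_def T_def W_def b_def)
qed

section \<open>The law of the walk\<close>

text \<open>
  The Markov property is assumed for complete histories only. The event is therefore cut into
  the countably many histories compatible with it; on each piece the identity is either the Markov
  property or, for a history of probability zero, trivial.
\<close>
lemma markov_chain_joint_step:
  assumes mc: "markov_chain M Q X"
  shows "\<P>(\<omega> in M. X 0 \<omega> = j \<and> X n \<omega> = i \<and> X (Suc n) \<omega> = k)
           = \<P>(\<omega> in M. X 0 \<omega> = j \<and> X n \<omega> = i) * Q i k"
proof -
  interpret prob_space M using mc by (simp add: markov_chain_def)
  have [measurable]: "X n \<in> measurable M (count_space UNIV)" for n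
    using mc by (simp add: markov_chain_def)
  \<comment> \<open>Histories are lists, hence countable; \<open>to_nat\<close> numbers the pieces.\<close>
  define hist where "hist \<omega> = map (\<lambda>r. X r \<omega>) [0..<Suc n]" for \<omega>
  define A where "A m = {\<omega>\<in>space M. X 0 \<omega> = j \<and> X n \<omega> = i \<and> to_nat (hist \<omega>) = m}" for m
  define B where "B = {\<omega>\<in>space M. X (Suc n) \<omega> = k}"
  have B: "B \<in> sets M" unfolding B_def by measurable
  have path: "A m = {} \<or> (\<exists>l. l n = i \<and> A m = {\<omega>\<in>space M. \<forall>r\<le>n. X r \<omega> = l r})" for m
  proof (cases "A m = {}")
    case False
    then obtain w where w: "w \<in> A m" by auto
    have "hist \<omega> = hist w \<longleftrightarrow> (\<forall>r\<le>n. X r \<omega> = X r w)" for \<omega>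
      by (auto simp: hist_def list_eq_iff_nth_eq less_Suc_eq_le simp del: upt_Suc)
    then have "A m = {\<omega>\<in>space M. \<forall>r\<le>n. X r \<omega> = X r w}"
      using w by (auto simp: A_def)
    then show ?thesis using w by (auto simp: A_def intro!: exI[of _ "\<lambda>r. X r w"])
  qed auto
  have A: "A m \<in> sets M" for m
    using path[of m] by auto
  have step: "measure M (A m \<inter> B) = measure M (A m) * Q i k" for m
    using path[of m]
  proof (elim disjE exE conjE)
    fix l assume l: "l n = i" "A m = {\<omega>\<in>space M. \<forall>r\<le>n. X r \<omega> = l r}"
    have AB: "A m \<inter> B = {\<omega>\<in>space M. X (Suc n) \<omega> = k \<and> (\<forall>r\<le>n. X r \<omega> = l r)}"
      by (auto simp: l B_def)
    show ?thesis
    proof (cases "measure M (A m) > 0")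
      case True
      then have "\<P>(\<omega> in M. X (Suc n) \<omega> = k \<bar> \<forall>r\<le>n. X r \<omega> = l r) = Q (l n) k"
        using mc unfolding markov_chain_def l(2) by blast
      then show ?thesis using True
        unfolding cond_prob_def AB[symmetric] l(2)[symmetric] by (simp add: field_simps l(1))
    next
      case False
      then have "measure M (A m) = 0" using measure_nonneg[of M "A m"] by linarith
      moreover have "measure M (A m \<inter> B) \<le> measure M (A m)"
        using A B by (intro finite_measure_mono) auto
      ultimately show ?thesis using measure_nonneg[of M "A m \<inter> B"] by simp
    qed
  qed auto
  have disj: "disjoint_family A"
    by (auto simp: A_def disjoint_family_on_def)
  have "(\<lambda>m. measure M (A m)) sums measure M (\<Union>m. A m)"
    using A by (intro finite_measure_UNION disj) blast
  from sums_mult2[OF this, of "Q i k"]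
  have "(\<lambda>m. measure M (A m \<inter> B)) sums (measure M (\<Union>m. A m) * Q i k)"
    by (simp add: step)
  moreover have "(\<lambda>m. measure M (A m \<inter> B)) sums measure M (\<Union>m. A m \<inter> B)"
    using A B disj by (intro finite_measure_UNION) (auto simp: disjoint_family_on_def)
  ultimately have "measure M (\<Union>m. A m \<inter> B) = measure M (\<Union>m. A m) * Q i k"
    by (rule sums_unique2[rotated])
  moreover have "(\<Union>m. A m) = {\<omega>\<in>space M. X 0 \<omega> = j \<and> X n \<omega> = i}"
    by (auto simp: A_def)
  moreover have "(\<Union>m. A m \<inter> B) = {\<omega>\<in>space M. X 0 \<omega> = j \<and> X n \<omega> = i \<and> X (Suc n) \<omega> = k}"
    by (auto simp: A_def B_def)
  ultimately show ?thesis by simp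
qed

lemma markov_chain_cond_prob_step:
  assumes mc: "markov_chain M Q X"
  shows "(\<lambda>i. \<P>(\<omega> in M. X n \<omega> = i \<bar> X 0 \<omega> = j) * Q i k) sums
           \<P>(\<omega> in M. X (Suc n) \<omega> = k \<bar> X 0 \<omega> = j)"
proof -
  interpret prob_space M using mc by (simp add: markov_chain_def)
  have [measurable]: "X n \<in> measurable M (count_space UNIV)" for n
    using mc by (simp add: markov_chain_def)
  have "(\<lambda>i. \<P>(\<omega> in M. X 0 \<omega> = j \<and> X n \<omega> = i \<and> X (Suc n) \<omega> = k)) sums
      measure M (\<Union>i. {\<omega>\<in>space M. X 0 \<omega> = j \<and> X n \<omega> = i \<and> X (Suc n) \<omega> = k})"
    by (rule finite_measure_UNION) (auto simp: disjoint_family_on_def)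
  also have "(\<Union>i. {\<omega>\<in>space M. X 0 \<omega> = j \<and> X n \<omega> = i \<and> X (Suc n) \<omega> = k})
      = {\<omega>\<in>space M. X (Suc n) \<omega> = k \<and> X 0 \<omega> = j}" by auto
  finally have "(\<lambda>i. \<P>(\<omega> in M. X n \<omega> = i \<and> X 0 \<omega> = j) * Q i k) sums
      \<P>(\<omega> in M. X (Suc n) \<omega> = k \<and> X 0 \<omega> = j)"
    unfolding markov_chain_joint_step[OF mc] by (simp only: conj_commute)
  from sums_divide[OF this, of "\<P>(\<omega> in M. X 0 \<omega> = j)"]
  show ?thesis by (simp add: cond_prob_def)
qed

text \<open>
  All that is used of the chain started at \<open>j\<close> is the forward equation for its law, where \<open>a n k\<close>
  stands for \<open>P(X\<^sub>n = k | X\<^sub>0 = j)\<close>. Inside this locale no probability space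
  is involved.
\<close>
locale walk_from =
  fixes p :: "nat \<Rightarrow> real" and N j :: nat and a :: "nat \<Rightarrow> nat \<Rightarrow> real"
  assumes p_nonneg: "p k \<ge> 0"
    and p_sum: "(\<Sum>k\<le>N. p k) = 1"
    and p_support: "k > N \<Longrightarrow> p k = 0"
    and p_odd: "even k \<Longrightarrow> p k = 0"
    and law_0: "a 0 k = of_bool (k = j)"
    and law_Suc: "(\<lambda>i. a n i * walk_trans p i k) sums a (Suc n) k"
begin

definition reach :: "nat \<Rightarrow> nat" where "reach n = j + n * (N + 1)"

text \<open>
  Bounded jumps keep each law finitely supported. Support and finite forward equation are proved
  together, as each step of one needs the other.
\<close>
lemma law_eq_0: "k > reach n \<Longrightarrow> a n k = 0"
  and law_Suc_sum: "a (Suc n) k = (\<Sum>i\<le>reach n. a n i * walk_trans p i k)"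
proof (induction n arbitrary: k)
  case 0
  {
    case 1 then show ?case by (simp add: law_0 reach_def)
  next
    case 2
    have "(\<lambda>i. a 0 i * walk_trans p i k) sums (\<Sum>i\<le>reach 0. a 0 i * walk_trans p i k)"
      by (rule sums_finite) (auto simp: law_0 reach_def)
    with law_Suc show ?case by (rule sums_unique2)
  }
next
  case (Suc n)
  have zero: "a (Suc n) k = 0" if "k > reach (Suc n)" for k
  proof -
    have "walk_trans p i k = 0" if "i \<le> reach n" for i
      using that \<open>k > reach (Suc n)\<close> by (auto simp: walk_trans_def reach_def p_support)
    then show ?thesis by (simp add: Suc.IH(2))
  qed
  {
    case 1 then show ?case by (rule zero)
  next
    case 2
    have "(\<lambda>i. a (Suc n) i * walk_trans p i k) sums (\<Sum>i\<le>reach (Suc n). a (Suc n) i * walk_trans p i k)"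
      by (rule sums_finite) (auto simp: zero)
    with law_Suc show ?case by (rule sums_unique2)
  }
qed

lemma law_nonneg: "a n k \<ge> 0"
proof (induction n arbitrary: k)
  case (Suc n)
  then show ?case
    by (auto simp: law_Suc_sum walk_trans_def p_nonneg intro!: sum_nonneg)
qed (simp add: law_0)

text \<open>
  Every step changes the parity of the position. The inequality \<open>j \<le> n + k\<close> hidden in the statement
  says that the origin cannot be reached before time \<open>j\<close>.
\<close>
lemma law_parity: "a n k \<noteq> 0 \<Longrightarrow> \<exists>t. n + k = j + 2 * t"
proof (induction n arbitrary: k)
  case 0
  then show ?case by (auto simp: law_0 intro!: exI[of _ 0])
next
  case (Suc n)
  then obtain i where i: "a n i \<noteq> 0" "walk_trans p i k \<noteq> 0"
    unfolding law_Suc_sum by (metis (no_types, lifting) mult_eq_0_iff sum.neutral)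
  then obtain t where t: "n + i = j + 2 * t" using Suc.IH by blast
  show ?case
  proof (cases "i = 0")
    case True
    then have "odd k" using i(2) p_odd by (auto simp: walk_trans_def)
    then obtain l where "k = 2 * l + 1" by (rule oddE)
    then have "Suc n + k = j + 2 * (t + l + 1)" using t True by simp
    then show ?thesis by blast
  next
    case False
    then have "k = i - 1 \<or> k = i + 1" using i(2) by (auto simp: walk_trans_def split: if_splits)
    then have "Suc n + k = j + 2 * t \<or> Suc n + k = j + 2 * (t + 1)" using t False by auto
    then show ?thesis by blast
  qed
qed

definition mean :: "nat \<Rightarrow> (nat \<Rightarrow> 'b) \<Rightarrow> 'b::real_normed_field" where
  "mean n f = (\<Sum>k\<le>reach n. of_real (a n k) * f k)"

text \<open>The Markov operator of the walk, acting on functions of the position.\<close>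
definition trans_op :: "(nat \<Rightarrow> 'b) \<Rightarrow> nat \<Rightarrow> 'b::real_normed_field" where
  "trans_op f i = (if i = 0 then \<Sum>k\<le>N. of_real (p k) * f k else (f (i - 1) + f (i + 1)) / 2)"

lemma mean_0: "mean 0 f = f j"
proof -
  have "mean 0 f = (\<Sum>k\<le>j. if k = j then f k else 0)"
    unfolding mean_def reach_def by (intro sum.cong) (auto simp: law_0)
  then show ?thesis by simp
qed

lemma mean_Suc: "mean (Suc n) f = mean n (trans_op f)"
proof -
  have inner: "(\<Sum>k\<le>reach (Suc n). of_real (walk_trans p i k) * f k) = trans_op f i"
    if "i \<le> reach n" for i
  proof (cases "i = 0")
    case True
    have "(\<Sum>k\<le>reach (Suc n). of_real (p k) * f k) = (\<Sum>k\<le>N. of_real (p k) * f k)"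
      by (rule sum.mono_neutral_right) (auto simp: reach_def p_support)
    then show ?thesis using True by (simp add: walk_trans_def trans_op_def)
  next
    case False
    have "(\<Sum>k\<le>reach (Suc n). of_real (walk_trans p i k) * f k)
        = (\<Sum>k\<in>{i - 1, i + 1}. of_real (walk_trans p i k) * f k)"
      using False that by (intro sum.mono_neutral_right) (auto simp: reach_def walk_trans_def)
    also have "\<dots> = trans_op f i"
      using False by (simp add: walk_trans_def trans_op_def field_simps)
    finally show ?thesis .
  qed
  have "mean (Suc n) f = (\<Sum>k\<le>reach (Suc n). \<Sum>i\<le>reach n. of_real (a n i) * (of_real (walk_trans p i k) * f k))"
    by (simp add: mean_def law_Suc_sum sum_distrib_right mult.assoc)
  also have "\<dots> = (\<Sum>i\<le>reach n. \<Sum>k\<le>reach (Suc n). of_real (a n i) * (of_real (walk_trans p i k) * f k))"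
    by (rule sum.swap)
  also have "\<dots> = mean n (trans_op f)"
    by (simp add: mean_def inner flip: sum_distrib_left)
  finally show ?thesis .
qed

lemma mean_add: "mean n (\<lambda>k. f k + g k) = mean n f + mean n g"
  by (simp add: mean_def distrib_left sum.distrib)

lemma mean_cmult: "mean n (\<lambda>k. c * f k) = c * mean n f"
  by (simp add: mean_def sum_distrib_left mult_ac)

lemma mean_indicator_0: "mean n (\<lambda>k. if k = 0 then c else 0) = c * of_real (a n 0)"
proof -
  have "mean n (\<lambda>k. if k = 0 then c else 0) = (\<Sum>k\<le>reach n. if k = 0 then c * of_real (a n 0) else 0)"
    unfolding mean_def by (intro sum.cong) auto
  then show ?thesis by simp
qed

lemma law_total: "(\<Sum>k\<le>reach n. a n k) = 1"
proof -
  have "trans_op (\<lambda>_. 1) = (\<lambda>_. 1 :: real)"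
    by (auto simp: trans_op_def p_sum)
  then have "mean n (\<lambda>_. 1 :: real) = 1"
    by (induction n) (simp_all add: mean_0 mean_Suc)
  then show ?thesis by (simp add: mean_def)
qed

lemma law_le_1: "a n k \<le> 1"
proof (cases "k \<le> reach n")
  case True
  then have "a n k \<le> (\<Sum>k\<le>reach n. a n k)"
    by (intro member_le_sum) (auto simp: law_nonneg)
  then show ?thesis by (simp add: law_total)
qed (simp add: law_eq_0)

lemma norm_mean_le: "(\<And>k. norm (f k) \<le> 1) \<Longrightarrow> norm (mean n f) \<le> 1"
proof -
  assume f: "\<And>k. norm (f k) \<le> 1"
  have "norm (mean n f) \<le> (\<Sum>k\<le>reach n. a n k * norm (f k))"
    unfolding mean_def by (rule order.trans[OF norm_sum]) (simp add: norm_mult law_nonneg)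
  also have "\<dots> \<le> (\<Sum>k\<le>reach n. a n k)"
    by (intro sum_mono mult_left_le f law_nonneg)
  finally show ?thesis by (simp add: law_total)
qed

text \<open>
  The identity is harmonic for the walk except at the origin, where a step adds the mean
  jump.
\<close>
lemma mean_position:
  "mean n real = real j + (\<Sum>k\<le>N. p k * real k) * (\<Sum>i<n. a i 0)"
proof (induction n)
  case 0
  then show ?case by (simp add: mean_0)
next
  case (Suc n)
  have "trans_op real = (\<lambda>k. real k + (if k = 0 then \<Sum>k\<le>N. p k * real k else 0))"
    by (auto simp: trans_op_def fun_eq_iff of_nat_diff)
  then show ?case
    by (simp add: mean_Suc mean_add mean_indicator_0 Suc algebra_simps)
qed

text \<open>
  The kernel method. For \<open>i \<ge> 1\<close> the choice of \<open>h\<close> makes \<open>k \<mapsto> h ^ k\<close> an eigenfunction of the walk with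
  eigenvalue \<open>1 / z\<close>, so \<open>z ^ n * E(h ^ X\<^sub>n)\<close> changes only through visits to the origin. It starts at
  \<open>h ^ j\<close> and tends to \<open>0\<close>; the series telescopes.
\<close>
lemma kernel_equation:
  fixes z h :: complex
  assumes z: "norm z < 1" and h: "norm h \<le> 1" and kernel: "z * (1 + h\<^sup>2) = 2 * h"
  shows "(\<lambda>n. of_real (a n 0) * z ^ n * (1 - (\<Sum>k\<le>N. of_real (p k) * (z * h ^ k)))) sums h ^ j"
proof -
  define c where "c = 1 - (\<Sum>k\<le>N. of_real (p k) * (z * h ^ k))"
  define A where "A n = z ^ n * mean n (\<lambda>k. h ^ k)" for n
  have op: "z * trans_op (\<lambda>k. h ^ k) i = h ^ i + (if i = 0 then - c else 0)" for i
  proof (cases i)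
    case (Suc m)
    have "z * ((h ^ m + h ^ (m + 2)) / 2) = h ^ m * (z * (1 + h\<^sup>2)) / 2"
      by (simp add: power_add power2_eq_square algebra_simps)
    then show ?thesis unfolding kernel by (simp add: trans_op_def Suc)
  qed (simp add: trans_op_def c_def sum_distrib_left mult_ac)
  have "A (Suc n) - A n = - (of_real (a n 0) * z ^ n * c)" for n
  proof -
    have "A (Suc n) = z ^ n * mean n (\<lambda>i. z * trans_op (\<lambda>k. h ^ k) i)"
      by (simp add: A_def mean_Suc mean_cmult)
    then show ?thesis
      by (simp add: op mean_add mean_indicator_0 A_def algebra_simps)
  qed
  moreover have "A \<longlonglongrightarrow> 0"
  proof (rule Lim_null_comparison)
    show "\<forall>\<^sub>F n in sequentially. norm (A n) \<le> norm z ^ n"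
      by (intro always_eventually allI)
        (auto simp: A_def norm_mult norm_power intro!: mult_left_le norm_mean_le power_le_one h)
    show "(\<lambda>n. norm z ^ n) \<longlonglongrightarrow> 0" using z by (intro LIMSEQ_realpow_zero) auto
  qed
  ultimately have "(\<lambda>n. - (of_real (a n 0) * z ^ n * c)) sums (0 - A 0)"
    using telescope_sums[of A 0] by simp
  from sums_minus[OF this] show ?thesis by (simp add: A_def mean_0 c_def)
qed

end

section \<open>Returns to the origin\<close>

text \<open>
  The expansion of \<open>(1 - s) ^ (l + 1) / (1 + s) ^ l\<close>, written in terms of the jump length
  \<open>k = 2 * l + 1\<close> to which it belongs. Passing from \<open>l\<close> to \<open>l + 1\<close> multiplies it by
  \<open>(1 - s) / (1 + s)\<close>.
\<close>
lemma fps_reflection_factor_nth: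
  fixes l :: nat
  defines "G \<equiv> (1 - fps_X) ^ (l + 1) * inverse ((1 + fps_X) ^ l) :: complex fps"
  defines "k \<equiv> 2 * of_nat l + 1 :: complex"
  shows "fps_nth G 0 = 1" "fps_nth G 1 = - k" "fps_nth G 2 = (k ^ 2 - 1) / 2"
    "fps_nth G 3 = (k - k ^ 3) / 6"
proof -
  have "fps_nth G 0 = 1 \<and> fps_nth G 1 = - k \<and> fps_nth G 2 = (k ^ 2 - 1) / 2 \<and> fps_nth G 3 = (k - k ^ 3) / 6"
    unfolding G_def k_def
  proof (induction l)
    case 0
    show ?case by simp
  next
    case (Suc l)
    define G where "G = ((1 - fps_X) ^ (l + 1) * inverse ((1 + fps_X) ^ l) :: complex fps)"
    define G' where "G' = ((1 - fps_X) ^ (Suc l + 1) * inverse ((1 + fps_X) ^ Suc l) :: complex fps)"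
    have "G' * (1 + fps_X) = G * (1 - fps_X) * (inverse (1 + fps_X) * (1 + fps_X))"
      unfolding G_def G'_def by (simp only: fps_inverse_mult power_Suc) (simp add: mult_ac)
    also have "inverse (1 + fps_X) * (1 + fps_X) = (1 :: complex fps)"
      by (rule inverse_mult_eq_1) simp
    finally have eq: "fps_nth (G' + G' * fps_X) n = fps_nth (G - G * fps_X) n" for n
      by (simp only: distrib_left right_diff_distrib mult_1_right)
    have G: "fps_nth G 0 = 1" "fps_nth G 1 = - (2 * of_nat l + 1)" "fps_nth G 2 = ((2 * of_nat l + 1) ^ 2 - 1) / 2"
      "fps_nth G 3 = ((2 * of_nat l + 1) - (2 * of_nat l + 1) ^ 3) / 6"
      using Suc by (simp_all add: G_def)
    have G'0: "fps_nth G' 0 = 1" using eq[of 0] G by simp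
    have "fps_nth G' (Suc n) = fps_nth G (Suc n) - fps_nth G n - fps_nth G' n" for n
      using eq[of "Suc n"] by (simp add: eq_diff_eq)
    from this[of 0] this[of 1] this[of 2]
    have rec: "fps_nth G' 1 = fps_nth G 1 - fps_nth G 0 - fps_nth G' 0"
      "fps_nth G' 2 = fps_nth G 2 - fps_nth G 1 - fps_nth G' 1"
      "fps_nth G' 3 = fps_nth G 3 - fps_nth G 2 - fps_nth G' 2"
      by (simp_all add: numeral_2_eq_2 numeral_3_eq_3)
    have G'1: "fps_nth G' 1 = - (2 * of_nat (Suc l) + 1)"
      unfolding rec G G'0 by simp
    have G'2: "fps_nth G' 2 = ((2 * of_nat (Suc l) + 1) ^ 2 - 1) / 2"
      unfolding rec(2) G G'1 by (simp add: field_simps power2_eq_square)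
    have G'3: "fps_nth G' 3 = ((2 * of_nat (Suc l) + 1) - (2 * of_nat (Suc l) + 1) ^ 3) / 6"
      unfolding rec(3) G G'2 by (simp add: field_simps power2_eq_square power3_eq_cube)
    show ?case using G'0 G'1 G'2 G'3 unfolding G'_def by blast
  qed
  then show "fps_nth G 0 = 1" "fps_nth G 1 = - k" "fps_nth G 2 = (k ^ 2 - 1) / 2"
    "fps_nth G 3 = (k - k ^ 3) / 6" by auto
qed

lemma fps_one_plus_X_power_nth:
  "fps_nth ((1 + fps_X) ^ j :: complex fps) 0 = 1"
  "fps_nth ((1 + fps_X) ^ j :: complex fps) 1 = of_nat j"
  "fps_nth ((1 + fps_X) ^ j :: complex fps) 2 = of_nat j * (of_nat j - 1) / 2"
proof (induction j)
  case (Suc j)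
  case 1 then show ?case using Suc by simp
  case 2 then show ?case using Suc by (simp add: distrib_right)
  case 3 then show ?case using Suc by (simp add: distrib_right field_simps)
qed auto

lemma fps_inverse_nth_012:
  fixes F K :: "complex fps"
  assumes "F * K = 1" "fps_nth K 0 \<noteq> 0"
  defines "c \<equiv> fps_nth K"
  shows "fps_nth F 0 = 1 / c 0" "fps_nth F 1 = - c 1 / c 0 ^ 2"
    "fps_nth F 2 = (c 1 ^ 2 - c 0 * c 2) / c 0 ^ 3"
proof -
  have eq: "fps_nth (F * K) n = fps_nth 1 n" for n using assms by simp
  have K: "c 0 \<noteq> 0" "\<And>n. fps_nth K n = c n" using assms by auto
  show F0: "fps_nth F 0 = 1 / c 0"
    using eq[of 0] K by (simp add: field_simps)
  show F1: "fps_nth F 1 = - c 1 / c 0 ^ 2"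
    using eq[of 1] K F0 by (simp add: fps_mult_nth field_simps power2_eq_square add_eq_0_iff)
  have "fps_nth F 2 * c 0 = - (fps_nth F 0 * c 2 + fps_nth F 1 * c 1)"
    using eq[of 2] K by (simp add: fps_mult_nth numeral_2_eq_2 add_eq_0_iff algebra_simps)
  also have "\<dots> = (c 1 ^ 2 - c 0 * c 2) / c 0 ^ 3 * c 0"
    unfolding F0 F1 using K(1) by (simp add: field_simps power2_eq_square power3_eq_cube)
  finally show "fps_nth F 2 = (c 1 ^ 2 - c 0 * c 2) / c 0 ^ 3"
    using K(1) mult_right_cancel by blast
qed

lemma norm_one_plus_gt_1:
  assumes "Re s \<ge> 0" "s \<noteq> 0" shows "norm (1 + s) > 1"
proof -
  have "Re s > 0 \<or> Im s \<noteq> 0" using assms complex_eq_iff[of s 0] by auto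
  then have "1 < (1 + Re s)\<^sup>2 + (Im s)\<^sup>2"
  proof
    assume "Re s > 0"
    then have "1 < (1 + Re s)\<^sup>2" by (simp add: power2_eq_square algebra_simps add_pos_pos)
    then show ?thesis using zero_le_power2[of "Im s"] by linarith
  next
    assume "Im s \<noteq> 0"
    then have "(Im s)\<^sup>2 > 0" by simp
    moreover have "1 \<le> (1 + Re s)\<^sup>2" using assms(1) by (simp add: power2_eq_square algebra_simps)
    ultimately show ?thesis by linarith
  qed
  then have "1\<^sup>2 < (norm (1 + s))\<^sup>2" by (simp add: cmod_power2)
  then show ?thesis by (rule power2_less_imp_less) auto
qed

context walk_from
begin

definition moment :: "nat \<Rightarrow> real" where
  "moment m = (\<Sum>k\<le>N. p k * real k ^ m)"

lemma moment_1_pos: "moment 1 > 0"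
proof -
  have "p k \<le> p k * real k" for k
    using p_odd[of k] p_nonneg[of k] by (cases k) (auto intro: mult_left_le mult_le_cancel_left1[THEN iffD2])
  then have "(\<Sum>k\<le>N. p k) \<le> moment 1" unfolding moment_def by (intro sum_mono) simp
  then show ?thesis using p_sum by simp
qed

text \<open>
  The function \<open>1 - z * (\<Sum>k. p k * h ^ k)\<close> of the kernel method in terms of \<open>s = csqrt (1 - z\<^sup>2)\<close>: for odd
  \<open>k\<close>, the relations \<open>h = z / (1 + s)\<close> and \<open>z\<^sup>2 = (1 - s) * (1 + s)\<close> turn \<open>z * h ^ k\<close> into the summand
  below. Up to the factor \<open>1 + h\<^sup>2\<close> it is the polynomial \<open>walk_phi p\<close> evaluated at \<open>h\<close>.
\<close>
definition char_fun :: "complex \<Rightarrow> complex" where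
  "char_fun s = 1 - (\<Sum>k\<le>N. of_real (p k) * ((1 - s) ^ (k div 2 + 1) * inverse ((1 + s) ^ (k div 2))))"

lemma char_fun_0: "char_fun 0 = 0"
  using p_sum by (simp add: char_fun_def flip: of_real_sum)

lemma holomorphic_char_fun: "char_fun holomorphic_on - {-1}"
proof -
  have "s \<noteq> - 1 \<Longrightarrow> 1 + s \<noteq> 0" for s :: complex
    by (simp add: add_eq_0_iff)
  then show ?thesis
    unfolding char_fun_def by (intro holomorphic_intros) auto
qed

text \<open>Only odd \<open>k\<close> have weight, and for these \<open>2 * (k div 2) + 1\<close> is \<open>k\<close> itself.\<close>
lemma p_times_parity:
  "complex_of_real (p k) * f (2 * of_nat (k div 2) + 1 :: complex) = of_real (p k) * f (of_nat k)"
proof (cases "even k")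
  case False
  then have "2 * of_nat (k div 2) + 1 = (of_nat k :: complex)"
    by (metis odd_two_times_div_two_succ of_nat_1 of_nat_add of_nat_mult of_nat_numeral)
  then show ?thesis by simp
qed (simp add: p_odd)

lemma char_fun_fps:
  obtains F where "char_fun has_fps_expansion F" "fps_nth F 1 = of_real (moment 1)"
    "fps_nth F 2 = of_real (- (moment 2 - 1) / 2)"
    "fps_nth F 3 = of_real ((moment 3 - moment 1) / 6)"
proof
  define G where "G l = ((1 - fps_X) ^ (l + 1) * inverse ((1 + fps_X) ^ l) :: complex fps)" for l
  define F where "F = 1 - (\<Sum>k\<le>N. fps_const (complex_of_real (p k)) * G (k div 2))"
  show "char_fun has_fps_expansion F"
    unfolding char_fun_def[abs_def] F_def G_def
    by (intro fps_expansion_intros) auto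
  have total: "(\<Sum>k\<le>N. complex_of_real (p k)) = 1"
    using p_sum by (simp flip: of_real_sum)
  have nth: "fps_nth F n = (if n = 0 then 1 else 0) - (\<Sum>k\<le>N. of_real (p k) * f (of_nat k))"
    if "\<And>l. fps_nth (G l) n = f (2 * of_nat l + 1)" for n and f :: "complex \<Rightarrow> complex"
    unfolding F_def fps_sub_nth fps_sum_nth fps_mult_left_const_nth that p_times_parity
    by simp
  have m: "(\<Sum>k\<le>N. complex_of_real (p k) * of_nat k ^ r) = of_real (moment r)" for r
    by (simp add: moment_def)
  have m1: "(\<Sum>k\<le>N. complex_of_real (p k) * of_nat k) = of_real (moment 1)"
    by (simp add: moment_def)
  have "fps_nth F 1 = - (\<Sum>k\<le>N. of_real (p k) * (- of_nat k))"
    by (subst nth[of 1 "\<lambda>k. - k"]) (simp_all only: G_def fps_reflection_factor_nth, simp)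
  then show "fps_nth F 1 = of_real (moment 1)"
    by (simp add: sum_negf m1)
  have "fps_nth F 2 = - (\<Sum>k\<le>N. of_real (p k) * ((of_nat k ^ 2 - 1) / 2))"
    by (subst nth[of 2 "\<lambda>k. (k ^ 2 - 1) / 2"]) (simp_all only: G_def fps_reflection_factor_nth, simp)
  also have "\<dots> = - ((\<Sum>k\<le>N. of_real (p k) * of_nat k ^ 2) - (\<Sum>k\<le>N. complex_of_real (p k))) / 2"
    unfolding sum_subtractf[symmetric] sum_divide_distrib[symmetric] minus_divide_left[symmetric]
    by (simp add: sum_divide_distrib right_diff_distrib)
  finally show "fps_nth F 2 = of_real (- (moment 2 - 1) / 2)"
    unfolding m total by simp
  have "fps_nth F 3 = - (\<Sum>k\<le>N. of_real (p k) * ((of_nat k - of_nat k ^ 3) / 6))"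
    by (subst nth[of 3 "\<lambda>k. (k - k ^ 3) / 6"]) (simp_all only: G_def fps_reflection_factor_nth, simp)
  also have "\<dots> = - ((\<Sum>k\<le>N. of_real (p k) * of_nat k) - (\<Sum>k\<le>N. complex_of_real (p k) * of_nat k ^ 3)) / 6"
    unfolding sum_subtractf[symmetric] sum_divide_distrib[symmetric] minus_divide_left[symmetric]
    by (simp add: sum_divide_distrib right_diff_distrib)
  finally show "fps_nth F 3 = of_real ((moment 3 - moment 1) / 6)"
    unfolding m m1 by simp
qed

text \<open>
  A zero would express \<open>1\<close> as an average, with weights \<open>p k\<close>, of numbers of modulus at most
  \<open>1 / norm (1 + s)\<close>, which is less than \<open>1\<close> on \<open>sqrt_disc\<close> except at \<open>s = 0\<close>.
\<close>
lemma char_fun_nonzero: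
  assumes "s \<in> sqrt_disc" "s \<noteq> 0"
  shows "char_fun s \<noteq> 0"
proof
  assume "char_fun s = 0"
  then have one: "(\<Sum>k\<le>N. of_real (p k) * ((1 - s) ^ (k div 2 + 1) * inverse ((1 + s) ^ (k div 2)))) = (1 :: complex)"
    by (simp add: char_fun_def)
  define q where "q = norm (1 + s)"
  have q: "q > 1" using assms by (auto simp: q_def sqrt_disc_def intro: norm_one_plus_gt_1)
  have "norm (1 - s) * q = norm (1 - s\<^sup>2)"
    by (simp add: q_def power2_eq_square algebra_simps flip: norm_mult)
  then have "norm (1 - s) * q \<le> 1" using assms by (simp add: sqrt_disc_def)
  then have r: "norm (1 - s) \<le> 1 / q" using q by (simp add: field_simps)
  have factor_le: "norm ((1 - s) ^ (l + 1) * inverse ((1 + s) ^ l)) \<le> 1 / q" for l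
  proof -
    have "norm ((1 - s) ^ (l + 1) * inverse ((1 + s) ^ l)) = norm (1 - s) * norm (1 - s) ^ l * (1 / q ^ l)"
      by (simp add: norm_mult norm_power norm_inverse norm_divide q_def inverse_eq_divide)
    also have "\<dots> \<le> (1 / q) * 1 * 1"
    proof (intro mult_mono r)
      have "1 / q \<le> 1" using q by simp
      with r have "norm (1 - s) \<le> 1" by linarith
      then show "norm (1 - s) ^ l \<le> 1" by (intro power_le_one) auto
      show "1 / q ^ l \<le> 1" using q by (simp add: one_le_power)
    qed (use q in auto)
    finally show ?thesis by simp
  qed
  have "1 = norm (\<Sum>k\<le>N. of_real (p k) * ((1 - s) ^ (k div 2 + 1) * inverse ((1 + s) ^ (k div 2))))"
    unfolding one by simp
  also have "\<dots> \<le> (\<Sum>k\<le>N. p k * (1 / q))"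
  proof (rule sum_norm_le)
    show "norm (of_real (p k) * ((1 - s) ^ (k div 2 + 1) * inverse ((1 + s) ^ (k div 2)))) \<le> p k * (1 / q)" for k
      unfolding norm_mult[of "of_real (p k)"] norm_of_real abs_of_nonneg[OF p_nonneg]
      by (rule mult_left_mono[OF factor_le p_nonneg])
  qed
  also have "\<dots> = 1 / q" using p_sum by (simp flip: sum_distrib_right sum_divide_distrib)
  finally show False using q by (simp add: field_simps)
qed

text \<open>
  The kernel equation for a square root \<open>z\<close> of \<open>y\<close>. Both sides carry a factor \<open>z ^ j\<close>, from the parity
  of the return times on the left and from \<open>h ^ j\<close> on the right; after cancelling it, only \<open>y\<close> and
  \<open>s\<close> remain. The cancellation needs \<open>y \<noteq> 0\<close>.
\<close>
lemma sums_return_probability: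
  fixes y :: complex
  assumes y: "norm y < 1" "y \<noteq> 0"
  defines "s \<equiv> csqrt (1 - y)"
  shows "(\<lambda>l. of_real (a (j + 2 * l) 0) * y ^ l) sums (1 / ((1 + s) ^ j * char_fun s))"
proof -
  define z where "z = csqrt y"
  define h where "h = z / (1 + s)"
  have z: "z\<^sup>2 = y" "z \<noteq> 0" using y by (auto simp: z_def)
  have "norm z ^ 2 < 1" using y(1) z(1) by (simp flip: norm_power)
  then have z1: "norm z < 1" by (simp add: power2_less_1_iff abs_less_iff flip: abs_square_less_1)
  have s: "s \<in> sqrt_disc" "s \<noteq> 0" using y csqrt_in_sqrt_disc[of y] by (auto simp: s_def)
  then have s1: "norm (1 + s) > 1" by (intro norm_one_plus_gt_1) (auto simp: sqrt_disc_def)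
  then have s0: "1 + s \<noteq> 0" by auto
  have ys: "y = (1 - s) * (1 + s)"
    using power2_csqrt[of "1 - y"] by (simp add: s_def[symmetric] power2_eq_square algebra_simps)
  have h: "norm h \<le> 1"
    using z1 s1 by (simp add: h_def norm_divide divide_simps)
  have kernel: "z * (1 + h\<^sup>2) = 2 * h"
  proof -
    have "h\<^sup>2 = (1 - s) / (1 + s)"
      unfolding h_def power_divide z(1) unfolding ys using s0 by (simp add: power2_eq_square)
    then have "1 + h\<^sup>2 = 2 / (1 + s)"
      using s0 by (simp add: add_divide_eq_iff)
    then show ?thesis by (simp add: h_def)
  qed
  have "of_real (p k) * (z * h ^ k) = of_real (p k) * ((1 - s) ^ (k div 2 + 1) * inverse ((1 + s) ^ (k div 2)))" for k
  proof (cases "even k")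
    case False
    then obtain l where k: "k = 2 * l + 1" by (rule oddE)
    have "z * h ^ k = z ^ (2 * (l + 1)) / (1 + s) ^ k"
      by (simp add: h_def power_divide k)
    also have "\<dots> = (1 - s) ^ (l + 1) * ((1 + s) ^ (l + 1) / (1 + s) ^ (l + 1 + l))"
      unfolding power_mult z(1) ys k by (simp add: power_mult_distrib mult_2)
    also have "\<dots> = (1 - s) ^ (l + 1) * inverse ((1 + s) ^ l)"
      unfolding power_add[of "1 + s" "l + 1" l] using s0
      by (simp add: inverse_eq_divide del: power_Suc)
    finally show ?thesis by (simp add: k)
  qed (simp add: p_odd)
  then have c: "1 - (\<Sum>k\<le>N. of_real (p k) * (z * h ^ k)) = char_fun s"
    by (simp only: char_fun_def)
  have c0: "char_fun s \<noteq> 0" using s by (rule char_fun_nonzero)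
  have "(\<lambda>n. of_real (a n 0) * z ^ n * char_fun s / (z ^ j * char_fun s)) sums (h ^ j / (z ^ j * char_fun s))"
    using sums_divide[OF kernel_equation[OF z1 h kernel]] unfolding c .
  then have all: "(\<lambda>n. of_real (a n 0) * z ^ n / z ^ j) sums (1 / ((1 + s) ^ j * char_fun s))"
    using c0 z(2) by (simp add: h_def power_divide mult.commute[of "char_fun s"] mult.assoc)
  have "strict_mono (\<lambda>l. j + 2 * l)" by (auto simp: strict_mono_def)
  moreover have "of_real (a n 0) * z ^ n / z ^ j = 0" if "n \<notin> range (\<lambda>l. j + 2 * l)" for n
    using that law_parity[of n 0] by auto
  ultimately have "(\<lambda>l. of_real (a (j + 2 * l) 0) * z ^ (j + 2 * l) / z ^ j) sums (1 / ((1 + s) ^ j * char_fun s))"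
    using all by (subst sums_mono_reindex[of "\<lambda>l. j + 2 * l"]) auto
  then show ?thesis
    using z by (simp add: power_add power_mult)
qed

text \<open>
  The generating function of the partial sums has the additional factor \<open>1 / (1 - y) = 1 / s\<^sup>2\<close>.
  Since \<open>char_fun\<close> has a simple zero at \<open>0\<close>, the singularity is of type \<open>s ^ (-3)\<close>, and \<open>\<alpha>\<close>, \<open>\<beta>\<close> are
  the normalised second and third Taylor coefficients of \<open>char_fun\<close>, up to sign.
\<close>
theorem visits_expansion:
  defines "\<alpha> \<equiv> (moment 2 - 1) / (2 * moment 1)" and "\<beta> \<equiv> (moment 3 - moment 1) / (6 * moment 1)"
  shows "three_halves_decay (\<lambda>L. of_real (moment 1 * (\<Sum>l\<le>L. a (j + 2 * l) 0)
      - (half_coeff_sum L + (\<alpha> - real j)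
         + (\<alpha>\<^sup>2 - \<beta> - real j * \<alpha> + real j * (real j + 1) / 2) * half_coeff L)))"
proof -
  let ?m = "\<lambda>r. complex_of_real (moment r)"
  have m1: "moment 1 \<noteq> 0" using moment_1_pos by simp
  obtain C where C: "char_fun has_fps_expansion C" "fps_nth C 1 = ?m 1"
    "fps_nth C 2 = of_real (- (moment 2 - 1) / 2)" "fps_nth C 3 = of_real ((moment 3 - moment 1) / 6)"
    by (rule char_fun_fps)
  obtain E where E: "E holomorphic_on - {-1}" "\<And>s. char_fun s = s * E s"
    using holomorphic_split_at_0[OF holomorphic_char_fun] by (auto simp: char_fun_0)
  have "open (- {-1 :: complex})" by (simp add: open_Compl)
  then have expE: "E has_fps_expansion fps_expansion E 0"
    by (rule has_fps_expansion_fps_expansion[OF _ _ E(1)]) auto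
  then have "(\<lambda>s. s * E s) has_fps_expansion fps_X * fps_expansion E 0"
    by (intro fps_expansion_intros)
  then have CE: "C = fps_X * fps_expansion E 0"
    using C(1) E(2) by (metis (no_types, lifting) ext fps_expansion_unique_complex)
  define K where "K = (1 + fps_X) ^ j * fps_expansion E 0"
  have e: "fps_nth (fps_expansion E 0) n = fps_nth C (Suc n)" for n
    by (simp add: CE)
  have e012: "fps_nth (fps_expansion E 0) 0 = ?m 1"
    "fps_nth (fps_expansion E 0) 1 = of_real (- (moment 2 - 1) / 2)"
    "fps_nth (fps_expansion E 0) 2 = of_real ((moment 3 - moment 1) / 6)"
    using C unfolding e by (simp_all add: numeral_2_eq_2 numeral_3_eq_3)
  have K0: "fps_nth K 0 = ?m 1"
    by (simp add: K_def e012 fps_one_plus_X_power_nth)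
  have K1: "fps_nth K 1 = of_real (- (moment 2 - 1) / 2 + real j * moment 1)"
    unfolding K_def fps_mult_nth_1 e012 fps_one_plus_X_power_nth fps_one_plus_X_power_nth(2)[simplified] e012(2)[simplified]
    by simp
  have K2: "fps_nth K 2 = of_real ((moment 3 - moment 1) / 6 - real j * (moment 2 - 1) / 2
      + real j * (real j - 1) / 2 * moment 1)"
  proof -
    have "fps_nth K 2 = (\<Sum>i=0..2. fps_nth ((1 + fps_X) ^ j) i * fps_nth (fps_expansion E 0) (2 - i))"
      unfolding K_def by (rule fps_mult_nth)
    also have "{0..2::nat} = {0, 1, 2}" by auto
    also have "(\<Sum>i\<in>\<dots>. fps_nth ((1 + fps_X) ^ j) i * fps_nth (fps_expansion E 0) (2 - i))
       = fps_nth ((1 + fps_X) ^ j) 0 * fps_nth (fps_expansion E 0) 2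
         + (fps_nth ((1 + fps_X) ^ j) 1 * fps_nth (fps_expansion E 0) 1
         + fps_nth ((1 + fps_X) ^ j) 2 * fps_nth (fps_expansion E 0) 0)"
      by (simp add: numeral_2_eq_2)
    also have "\<dots> = of_real ((moment 3 - moment 1) / 6 - real j * (moment 2 - 1) / 2
      + real j * (real j - 1) / 2 * moment 1)"
      unfolding e012 fps_one_plus_X_power_nth by (simp add: field_simps)
    finally show ?thesis .
  qed
  define U where "U = {s \<in> - {-1}. E s \<noteq> 0}"
  define B where "B = (\<lambda>s. inverse ((1 + s) ^ j * E s))"
  have E0: "E 0 \<noteq> 0" using e012(1) m1 by (simp add: fps_expansion_def)
  have "open (- {-1} \<inter> E -` (- {0}))"
    using E(1) by (intro continuous_open_preimage holomorphic_on_imp_continuous_on) (auto simp: open_Compl)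
  also have "- {-1} \<inter> E -` (- {0}) = U" by (auto simp: U_def)
  finally have U: "open U" .
  have sub: "sqrt_disc \<subseteq> U"
    using E0 E(2) char_fun_nonzero by (fastforce simp: U_def sqrt_disc_def)
  have B: "B holomorphic_on U"
    unfolding B_def U_def using E(1) by (intro holomorphic_intros) (auto intro: holomorphic_on_subset simp: add_eq_0_iff)
  have expB: "B has_fps_expansion inverse K"
    unfolding B_def K_def using expE K0 m1 by (intro fps_expansion_intros) (auto simp: K_def)
  have sums: "(\<lambda>L. of_real (\<Sum>l\<le>L. a (j + 2 * l) 0) * y ^ L) sums (B (csqrt (1 - y)) / csqrt (1 - y) ^ 3)"
    if y: "norm y < 1" "y \<noteq> 0" for y
  proof -
    define s where "s = csqrt (1 - y)"
    have s: "s \<noteq> 0" "1 - y = s\<^sup>2" using y by (auto simp: s_def)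
    have "bdiff (\<lambda>L. complex_of_real (\<Sum>l\<le>L. a (j + 2 * l) 0)) l = of_real (a (j + 2 * l) 0)" for l
      by (cases l) (auto simp: bdiff_def)
    moreover have "norm (complex_of_real (\<Sum>l\<le>L. a (j + 2 * l) 0)) \<le> 2 * real L + 1" for L
    proof -
      have "(\<Sum>l\<le>L. a (j + 2 * l) 0) \<le> (\<Sum>l\<le>L. 1)" by (intro sum_mono law_le_1)
      moreover have "(\<Sum>l\<le>L. a (j + 2 * l) 0) \<ge> 0" by (intro sum_nonneg law_nonneg)
      ultimately show ?thesis unfolding norm_of_real by simp
    qed
    ultimately have "(\<lambda>L. of_real (\<Sum>l\<le>L. a (j + 2 * l) 0) * y ^ L) sums
        (1 / ((1 + s) ^ j * char_fun s) / (1 - y))"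
      using sums_return_probability[OF y] y(1) unfolding s_def[symmetric] by (intro sums_of_bdiff) auto
    also have "1 / ((1 + s) ^ j * char_fun s) / (1 - y) = B s / s ^ 3"
      unfolding E(2) s(2) B_def using s(1) by (simp add: power2_eq_square power3_eq_cube divide_inverse mult_ac)
    finally show ?thesis by (simp only: s_def)
  qed
  have FK: "inverse K * K = 1" using K0 m1 by (intro inverse_mult_eq_1) auto
  have "fps_nth K 0 \<noteq> 0" using K0 m1 by simp
  note F = fps_inverse_nth_012[OF FK this, unfolded K0 K1 K2]
  define r0 where "r0 = 1 / moment 1"
  define r1 where "r1 = - (- (moment 2 - 1) / 2 + real j * moment 1) / moment 1 ^ 2"
  define r2 where "r2 = ((- (moment 2 - 1) / 2 + real j * moment 1) ^ 2
         - moment 1 * ((moment 3 - moment 1) / 6 - real j * (moment 2 - 1) / 2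
      + real j * (real j - 1) / 2 * moment 1)) / moment 1 ^ 3"
  have F': "fps_nth (inverse K) 0 = of_real r0" "fps_nth (inverse K) 1 = of_real r1"
    "fps_nth (inverse K) 2 = of_real r2"
    unfolding F r0_def r1_def r2_def by simp_all
  have r: "moment 1 * r0 = 1" "moment 1 * r1 = \<alpha> - real j"
      "moment 1 * r2 = \<alpha>\<^sup>2 - \<beta> - real j * \<alpha> + real j * (real j + 1) / 2"
      using m1 unfolding \<alpha>_def \<beta>_def r0_def r1_def r2_def
      by (simp_all add: field_simps power2_eq_square power3_eq_cube)
  have "three_halves_decay (\<lambda>L. of_real (\<Sum>l\<le>L. a (j + 2 * l) 0)
        - (fps_nth (inverse K) 0 * of_real (half_coeff_sum L) + fps_nth (inverse K) 1
           + fps_nth (inverse K) 2 * of_real (half_coeff L)))"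
    by (rule coeff_expansion_of_sqrt_singularity[OF B U sub expB]) (rule sums)
  from three_halves_decay_cmult[OF this, of "?m 1"]
  show ?thesis
  proof (rule back_subst[where P = three_halves_decay], intro ext)
    fix L
    have "moment 1 * (S - (r0 * T + r1 + r2 * W))
        = moment 1 * S - (moment 1 * r0 * T + moment 1 * r1 + moment 1 * r2 * W)" for S T W
      by (simp only: right_diff_distrib distrib_left mult.assoc)
    note eq = this[unfolded r mult_1_left]
    show "?m 1 * (of_real (\<Sum>l\<le>L. a (j + 2 * l) 0)
        - (fps_nth (inverse K) 0 * of_real (half_coeff_sum L) + fps_nth (inverse K) 1 + fps_nth (inverse K) 2 * of_real (half_coeff L)))
      = of_real (moment 1 * (\<Sum>l\<le>L. a (j + 2 * l) 0)
      - (half_coeff_sum L + (\<alpha> - real j)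
         + (\<alpha>\<^sup>2 - \<beta> - real j * \<alpha> + real j * (real j + 1) / 2) * half_coeff L))"
      unfolding F' eq[symmetric] by (simp only: of_real_mult of_real_add of_real_diff)
  qed
qed

end

section \<open>The expected position\<close>

context walk_from
begin

text \<open>
  Visits occur only at times of the parity of \<open>j\<close>, so the sums up to \<open>n = j + 1 + 2 * L\<close> and up to
  \<open>n = j + 2 + 2 * L\<close> agree. That \<open>n - 2 * L\<close> takes two values is the source of the alternating
  term.
\<close>
lemma sum_visits:
  assumes "\<epsilon> \<le> 1"
  shows "(\<Sum>i<j + 1 + 2 * L + \<epsilon>. a i 0) = (\<Sum>l\<le>L. a (j + 2 * l) 0)"
proof -
  have "(\<Sum>i<j + 1 + 2 * L + \<epsilon>. a i 0) = (\<Sum>i\<in>(\<lambda>l. j + 2 * l) ` {..L}. a i 0)"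
  proof (rule sum.mono_neutral_right)
    show "\<forall>i\<in>{..<j + 1 + 2 * L + \<epsilon>} - (\<lambda>l. j + 2 * l) ` {..L}. a i 0 = 0"
    proof
      fix i assume i: "i \<in> {..<j + 1 + 2 * L + \<epsilon>} - (\<lambda>l. j + 2 * l) ` {..L}"
      show "a i 0 = 0"
      proof (rule ccontr)
        assume "a i 0 \<noteq> 0"
        then obtain t where "i = j + 2 * t" using law_parity[of i 0] by auto
        then show False using i assms by auto
      qed
    qed
  qed auto
  also have "\<dots> = (\<Sum>l\<le>L. a (j + 2 * l) 0)"
    by (subst sum.reindex) (auto simp: inj_on_def)
  finally show ?thesis .
qed

definition expansion :: "nat \<Rightarrow> real" where
  "expansion n = 2 / sqrt (2 * pi) * sqrt (real n)
     + (moment 2 - 1) / (2 * moment 1)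
     + 1 / sqrt (2 * pi) *
       (1/3 - moment 3 / (3 * moment 1) + (moment 2 - 1)\<^sup>2 / (2 * (moment 1)\<^sup>2)
        - real j * ((moment 2 - 1) / moment 1) + (real j)\<^sup>2
        + 1/2 * (-1) ^ (n + j + 1))
       * (1 / sqrt (real n))"

text \<open>
  Substitute the expansions of \<open>half_coeff_sum L\<close> and \<open>half_coeff L\<close> in terms of
  \<open>n = j + 1 + 2 * L + \<epsilon>\<close> into \<open>visits_expansion\<close> and collect powers of \<open>sqrt n\<close>. The parity of \<open>n + j\<close>
  enters through \<open>(-1) ^ (n + j + 1) / 2 = 1/2 - \<epsilon>\<close>.
\<close>
lemma mean_position_near_expansion:
  "\<exists>C. \<forall>L\<ge>1. \<forall>\<epsilon>\<le>1. \<bar>mean (j + 1 + 2 * L + \<epsilon>) real - expansion (j + 1 + 2 * L + \<epsilon>)\<bar>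
          \<le> C / (real L * sqrt (real L))"
proof -
  define \<alpha> where "\<alpha> = (moment 2 - 1) / (2 * moment 1)"
  define \<beta> where "\<beta> = (moment 3 - moment 1) / (6 * moment 1)"
  define c where "c = \<alpha>\<^sup>2 - \<beta> - real j * \<alpha> + real j * (real j + 1) / 2"
  define V where "V L = moment 1 * (\<Sum>l\<le>L. a (j + 2 * l) 0)" for L
  obtain C where C: "\<bar>V L - (half_coeff_sum L + (\<alpha> - real j) + c * half_coeff L)\<bar>
      * (real (L + 1) * sqrt (real (L + 1))) \<le> C" for L
    using visits_expansion unfolding three_halves_decay_def \<alpha>_def[symmetric] \<beta>_def[symmetric]
      c_def[symmetric] V_def[symmetric] norm_of_real by blast
  \<comment> \<open>An upper bound, uniform in \<open>\<epsilon>\<close>, for the shift \<open>b\<close> below.\<close>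
  define B where "B = real j + 3/2"
  have "\<bar>mean (j + 1 + 2 * L + \<epsilon>) real - expansion (j + 1 + 2 * L + \<epsilon>)\<bar>
          \<le> (C + (3 + 2 * (1 + B)\<^sup>2) + \<bar>c\<bar> * (1 + B)) / (real L * sqrt (real L))"
    if L: "L \<ge> 1" and \<epsilon>: "\<epsilon> \<le> 1" for L \<epsilon>
  proof -
    define n where "n = j + 1 + 2 * L + \<epsilon>"
    define b where "b = real j + real \<epsilon> + 1/2"
    define d where "d = real L * sqrt (real L)"
    define k where "k = 2 / sqrt (2 * pi)"
    define r where "r = sqrt (real n)"
    have n: "2 * real L + 1/2 + b = real n" by (simp add: n_def b_def)
    have b: "0 \<le> b" "b \<le> B" using \<epsilon> by (auto simp: b_def B_def)
    have d: "d > 0" using L by (simp add: d_def)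
    have "\<bar>half_coeff_sum L - k * (r + (1/2 - b/2) / r)\<bar> \<le> (3 + 2 * (1 + b)\<^sup>2) / d"
      using half_coeff_sum_shift[OF L b(1)] unfolding n half_coeff_sum_def k_def r_def d_def .
    also have "\<dots> \<le> (3 + 2 * (1 + B)\<^sup>2) / d"
      using b d by (intro divide_right_mono add_left_mono mult_left_mono power_mono) auto
    finally have 1: "\<bar>half_coeff_sum L - k * (r + (1/2 - b/2) / r)\<bar> \<le> (3 + 2 * (1 + B)\<^sup>2) / d" .
    have "\<bar>half_coeff L - k / r\<bar> \<le> (1 + b) / d"
      using half_coeff_shift[OF L b(1)] unfolding n k_def r_def d_def .
    also have "\<dots> \<le> (1 + B) / d" using b d by (intro divide_right_mono) auto
    finally have "\<bar>c\<bar> * \<bar>half_coeff L - k / r\<bar> \<le> \<bar>c\<bar> * ((1 + B) / d)"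
      by (intro mult_left_mono) auto
    then have 2: "\<bar>c * half_coeff L - c * (k / r)\<bar> \<le> \<bar>c\<bar> * (1 + B) / d"
      unfolding right_diff_distrib[symmetric] abs_mult by simp
    define e where "e = \<bar>V L - (half_coeff_sum L + (\<alpha> - real j) + c * half_coeff L)\<bar>"
    have "d \<le> real (L + 1) * sqrt (real (L + 1))"
      unfolding d_def by (intro mult_mono) auto
    then have "e * d \<le> e * (real (L + 1) * sqrt (real (L + 1)))"
      by (intro mult_left_mono) (auto simp: e_def)
    also have "\<dots> \<le> C" unfolding e_def by (rule C)
    finally have 3: "e \<le> C / d" using d by (simp add: field_simps)
    have mean: "mean n real = real j + V L"
      unfolding mean_position n_def sum_visits[OF \<epsilon>] V_def moment_def by simp
    have parity: "1/2 * (-1) ^ (n + j + 1) = 1/2 - real \<epsilon>"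
    proof -
      have "n + j + 1 = 2 * (j + 1 + L) + \<epsilon>" by (simp add: n_def)
      then have "(-1 :: real) ^ (n + j + 1) = (-1) ^ \<epsilon>"
        by (simp only: power_add power_mult power2_minus) simp
      moreover have "\<epsilon> = 0 \<or> \<epsilon> = 1" using \<epsilon> by linarith
      ultimately show ?thesis by auto
    qed
    have bracket: "1/3 - moment 3 / (3 * moment 1) + (moment 2 - 1)\<^sup>2 / (2 * (moment 1)\<^sup>2)
        - real j * ((moment 2 - 1) / moment 1) + (real j)\<^sup>2 + (1/2 - real \<epsilon>) = 2 * (1/2 - b/2 + c)"
    proof -
      have m1: "moment 1 \<noteq> 0" using moment_1_pos by simp
      have 1: "(moment 2 - 1) / moment 1 = 2 * \<alpha>"
        using m1 by (simp add: \<alpha>_def field_simps)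
      have 2: "(moment 2 - 1)\<^sup>2 / (2 * (moment 1)\<^sup>2) = 2 * \<alpha>\<^sup>2"
        by (simp add: \<alpha>_def power_divide power_mult_distrib)
      have 3: "1/3 - moment 3 / (3 * moment 1) = - 2 * \<beta>"
        using m1 by (simp add: \<beta>_def divide_simps)
      have "2 * c = 2 * \<alpha>\<^sup>2 - 2 * \<beta> - 2 * (real j * \<alpha>) + (real j)\<^sup>2 + real j"
        by (simp add: c_def power2_eq_square algebra_simps)
      then show ?thesis unfolding 1 2 3 b_def by (simp add: field_simps)
    qed
    have "expansion n = k * r + \<alpha> + 1 / sqrt (2 * pi) * (2 * (1/2 - b/2 + c)) * (1 / r)"
      unfolding expansion_def parity bracket k_def r_def \<alpha>_def ..
    also have "\<dots> = k * (r + (1/2 - b/2) / r) + \<alpha> + c * (k / r)"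
      unfolding k_def by (simp add: distrib_left right_diff_distrib add_divide_distrib diff_divide_distrib)
    finally have "\<bar>mean n real - expansion n\<bar> \<le> e + (3 + 2 * (1 + B)\<^sup>2) / d + \<bar>c\<bar> * (1 + B) / d"
      unfolding mean e_def using 1 2 by linarith
    also have "\<dots> \<le> (C + (3 + 2 * (1 + B)\<^sup>2) + \<bar>c\<bar> * (1 + B)) / d"
      using 3 by (simp add: add_divide_distrib)
    finally show ?thesis unfolding n_def d_def .
  qed
  then show ?thesis by blast
qed

theorem mean_position_expansion:
  "(\<lambda>n. mean n real - expansion n) \<in> O(\<lambda>n. 1 / real n powr (3/2))"
proof -
  obtain C where C: "\<And>L \<epsilon>. L \<ge> 1 \<Longrightarrow> \<epsilon> \<le> 1 \<Longrightarrow>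
      \<bar>mean (j + 1 + 2 * L + \<epsilon>) real - expansion (j + 1 + 2 * L + \<epsilon>)\<bar> \<le> C / (real L * sqrt (real L))"
    using mean_position_near_expansion by blast
  have "C \<ge> 0" using order.trans[OF abs_ge_zero C[of 1 0]] by simp
  show ?thesis
  \<comment> \<open>\<open>L \<ge> n / 4\<close> eventually, and \<open>8 = 4 * sqrt 4\<close>.\<close>
  proof (rule bigoI[where c = "8 * C"], rule eventually_sequentiallyI[of "2 * j + 4"])
    fix n assume n: "n \<ge> 2 * j + 4"
    define L where "L = (n - (j + 1)) div 2"
    define \<epsilon> where "\<epsilon> = (n - (j + 1)) mod 2"
    have split: "n = j + 1 + 2 * L + \<epsilon>" using n by (simp add: L_def \<epsilon>_def)
    have \<epsilon>: "\<epsilon> \<le> 1" by (simp add: \<epsilon>_def)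
    have L: "L \<ge> 1" "real n / 4 \<le> real L" using split n \<epsilon> by linarith+
    have n0: "real n > 0" using n by simp
    have "real n / 4 * sqrt (real n / 4) \<le> real L * sqrt (real L)"
      using L by (intro mult_mono) auto
    also have "real n / 4 * sqrt (real n / 4) = real n * sqrt (real n) / 8"
      by (simp add: real_sqrt_divide)
    finally have "C / (real L * sqrt (real L)) \<le> C / (real n * sqrt (real n) / 8)"
      using n0 \<open>C \<ge> 0\<close> L by (intro divide_left_mono) auto
    with C[OF L(1) \<epsilon>] have "\<bar>mean n real - expansion n\<bar> \<le> C / (real n * sqrt (real n) / 8)"
      unfolding split[symmetric] by linarith
    then show "norm (mean n real - expansion n) \<le> 8 * C * norm (1 / real n powr (3/2))"
      using n0 by (simp add: powr_three_halves mult.commute)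
  qed
qed

end

theorem theorem2:
  fixes p :: "nat \<Rightarrow> real" and M :: "'a measure" and X :: "nat \<Rightarrow> 'a \<Rightarrow> nat" and j :: nat
  assumes p_nonneg: "\<And>k. p k \<ge> 0"
    and p_sum: "p sums 1"
    and walk: "markov_chain M (walk_trans p) X"
    and A2c: "\<And>k. even k \<Longrightarrow> p k = 0"
    and A3: "\<exists>N>0. \<forall>k>N. p k = 0"
    and A4: "rsquarefree (walk_phi p)"
    and start: "\<P>(\<omega> in M. X 0 \<omega> = j) > 0"
  defines "m \<equiv> jump_moment p"
  shows "(\<lambda>n. cond_expected_position M X n j -
            (2 / sqrt (2 * pi) * sqrt (real n)
             + (m 2 - 1) / (2 * m 1)
             + 1 / sqrt (2 * pi) *
               (1/3 - m 3 / (3 * m 1) + (m 2 - 1)\<^sup>2 / (2 * (m 1)\<^sup>2)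
                - real j * ((m 2 - 1) / m 1) + (real j)\<^sup>2
                + 1/2 * (-1) ^ (n + j + 1))
               * (1 / sqrt (real n))))
         \<in> O(\<lambda>n. 1 / real n powr (3/2))"
proof -
  obtain N where N: "\<And>k. k > N \<Longrightarrow> p k = 0" using A3 by blast
  define a where "a n k = \<P>(\<omega> in M. X n \<omega> = k \<bar> X 0 \<omega> = j)" for n k
  interpret walk_from p N j a
  proof
    have "p sums (\<Sum>k\<le>N. p k)" by (rule sums_finite) (auto intro: N)
    then show "(\<Sum>k\<le>N. p k) = 1" using p_sum by (rule sums_unique2)
    show "a 0 k = of_bool (k = j)" for k
    proof (cases "k = j")
      case True
      then show ?thesis using start by (simp add: a_def cond_prob_def)
    next
      case False
      then have "{\<omega> \<in> space M. X 0 \<omega> = k \<and> X 0 \<omega> = j} = {}" by auto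
      then show ?thesis unfolding a_def cond_prob_def using False by (simp only: measure_empty) simp
    qed
    show "(\<lambda>i. a n i * walk_trans p i k) sums a (Suc n) k" for n k
      unfolding a_def by (rule markov_chain_cond_prob_step[OF walk])
  qed (use p_nonneg A2c N in auto)
  have "m r = moment r" for r
    unfolding m_def jump_moment_def moment_def by (rule suminf_finite) (auto simp: N)
  moreover have "cond_expected_position M X n j = mean n real" for n
  proof -
    have "cond_expected_position M X n j = (\<Sum>k\<le>reach n. real k * a n k)"
      unfolding cond_expected_position_def a_def[symmetric]
      by (rule suminf_finite) (auto simp: law_eq_0)
    then show ?thesis by (simp add: mean_def mult.commute)
  qed
  ultimately show ?thesis
    using mean_position_expansion unfolding expansion_def by simp
qed

end
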